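(* Let $0<s<1$, let $N$ be a positive integer with $N>2s$, let $m>0$ and $2^*_s=\frac{2N}{N-2s}$. Define $$\Lambda=\inf_{u\in H^s(\mathbb{R}^N)\setminus\{0\}}\frac{\int_{\mathbb{R}^N}(m^2+4\pi^2|\xi|^2)^s|\hat u(\xi)|^2\,d\xi}{\left(\int_{\mathbb{R}^N}|u|^{2^*_s}\,dx\right)^{2/2^*_s}},\qquad S=\inf_{u\in H^s(\mathbb{R}^N)\setminus\{0\}}\frac{\int_{\mathbb{R}^N}(2\pi|\xi|)^{2s}|\hat u(\xi)|^2\,d\xi}{\left(\int_{\mathbb{R}^N}|u|^{2^*_s}\,dx\right)^{2/2^*_s}} .$$ Then $0<\Lambda<\infty$, the infimum $\Lambda$ is not attained, and $\Lambda=S$.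
   Context: Fourier transform: $\hat u(\xi)=\int_{\mathbb{R}^N}e^{-2\pi i x\cdot\xi}u(x)\,dx$. $H^s(\mathbb{R}^N)$ is the space of real-valued $u\in L^2(\mathbb{R}^N)$ with $\int_{\mathbb{R}^N}(m^2+4\pi^2|\xi|^2)^s|\hat u(\xi)|^2d\xi<\infty$. *)

theory Defs
  imports "HOL-Analysis.Analysis"
begin

definition square_integrable :: "('a::euclidean_space \<Rightarrow> 'b::real_normed_vector) \<Rightarrow> bool" where
  "square_integrable f \<longleftrightarrow>
     f \<in> borel_measurable lborel \<and> integrable lborel (\<lambda>x. (norm (f x))\<^sup>2)"

definition fourier_integral :: "('a::euclidean_space \<Rightarrow> complex) \<Rightarrow> 'a \<Rightarrow> complex" where
  "fourier_integral f \<xi> =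
     (LINT x|lborel. exp (- (2 * complex_of_real pi * \<i> * complex_of_real (x \<bullet> \<xi>))) * f x)"

definition ball_truncation :: "real \<Rightarrow> ('a::euclidean_space \<Rightarrow> complex) \<Rightarrow> 'a \<Rightarrow> complex" where
  "ball_truncation R f x = (if norm x \<le> R then f x else 0)"

text \<open>
  The integral defining the Fourier transform need not converge for \<open>f\<close> in $L^2$, so the transform
  on $L^2$ is taken in Plancherel's sense: it is the $L^2$ limit, as \<open>R\<close> tends to infinity, of the
  transforms of the restrictions of \<open>f\<close> to balls of radius \<open>R\<close> (these restrictions are in
  $L^1$ as well as $L^2$).  The limit is determined only up to a null set.  The distance is a
  nonnegative integral with values in \<open>ennreal\<close>, since the Bochner integral would return \<open>0\<close> for an
  infinite distance.
\<close>

definition has_fourier_L2 ::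
    "('a::euclidean_space \<Rightarrow> complex) \<Rightarrow> ('a \<Rightarrow> complex) \<Rightarrow> bool" where
  "has_fourier_L2 f g \<longleftrightarrow>
     square_integrable g \<and>
     ((\<lambda>R::real. \<integral>\<^sup>+ \<xi>. ennreal ((norm (fourier_integral (ball_truncation R f) \<xi> - g \<xi>))\<^sup>2) \<partial>lborel)
        \<longlongrightarrow> 0) at_top"

definition fourier_L2 :: "('a::euclidean_space \<Rightarrow> real) \<Rightarrow> 'a \<Rightarrow> complex" where
  "fourier_L2 u = (SOME g. has_fourier_L2 (\<lambda>x. complex_of_real (u x)) g)"

text \<open>
  Elements of $L^2$ are represented by Borel functions rather than by equivalence classes, so
  the zero element corresponds to the functions vanishing almost everywhere.
\<close>

definition Hs :: "real \<Rightarrow> real \<Rightarrow> ('a::euclidean_space \<Rightarrow> real) set" where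
  "Hs m s = {u. square_integrable u \<and>
     (\<integral>\<^sup>+ \<xi>. ennreal ((m\<^sup>2 + 4 * pi\<^sup>2 * (norm \<xi>)\<^sup>2) powr s * (norm (fourier_L2 u \<xi>))\<^sup>2) \<partial>lborel) < \<infinity>}"

definition Hs_nonzero :: "real \<Rightarrow> real \<Rightarrow> ('a::euclidean_space \<Rightarrow> real) set" where
  "Hs_nonzero m s = {u \<in> Hs m s. \<not> (AE x in lborel. u x = 0)}"

definition critical_exponent :: "nat \<Rightarrow> real \<Rightarrow> real" where
  "critical_exponent N s = 2 * real N / (real N - 2 * s)"

text \<open>
  In the two quotients the numerators are finite for every \<open>u\<close> in \<open>Hs m s\<close> with \<open>m > 0\<close> and \<open>s > 0\<close>,
  and the denominator vanishes for no nonzero \<open>u\<close>.  Were the integral in the denominator infinite, the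
  Bochner integral would be \<open>0\<close> and the quotient \<open>0\<close>, in agreement with $a/\infty = 0$.
\<close>

definition Lambda_quotient :: "real \<Rightarrow> real \<Rightarrow> ('a::euclidean_space \<Rightarrow> real) \<Rightarrow> real" where
  "Lambda_quotient m s u =
     (LINT \<xi>|lborel. (m\<^sup>2 + 4 * pi\<^sup>2 * (norm \<xi>)\<^sup>2) powr s * (norm (fourier_L2 u \<xi>))\<^sup>2)
     / (LINT x|lborel. \<bar>u x\<bar> powr critical_exponent DIM('a) s) powr (2 / critical_exponent DIM('a) s)"

definition S_quotient :: "real \<Rightarrow> ('a::euclidean_space \<Rightarrow> real) \<Rightarrow> real" where
  "S_quotient s u =
     (LINT \<xi>|lborel. (2 * pi * norm \<xi>) powr (2 * s) * (norm (fourier_L2 u \<xi>))\<^sup>2)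
     / (LINT x|lborel. \<bar>u x\<bar> powr critical_exponent DIM('a) s) powr (2 / critical_exponent DIM('a) s)"

end

theory Submission imports Defs "HOL-Probability.Probability" begin

text \<open>
  Plancherel's theorem is obtained by Gaussian regularisation: the autocorrelation
  $H(w) = \int f(x) \overline{f(x - w)}\,dx$ has Fourier transform $|\hat f|^2$, so
  $\int |\hat f(\xi)|^2 e^{-\varepsilon^2|\xi|^2/2}\,d\xi$ is the average of $H(\varepsilon w)$ against a
  Gaussian of integral one, and $H$ is continuous at $0$ because translations are continuous in $L^2$.

  The fractional Sobolev inequality, which makes both infima positive, follows Chemin and Xu: at each
  level $t$ split $u$ at a frequency $A(t)$ such that the low frequency part is at most $t/2$ pointwise
  (Cauchy-Schwarz against $|\xi|^{-s}$, locally square integrable since $2s < N$). Chebyshev bounds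
  $|\{|u| > t\}|$ by the $L^2$ norm of the high frequencies, and integrating over $t$ with
  Fubini gives the inequality.

  The mass is then removed by scaling: the quotient with mass $m$ at $u(c\,\cdot)$ is the quotient with mass
  $m/c$ at $u$, which tends to the massless one as $c \to \infty$. Hence the infima agree. As the massive
  quotient is strictly larger than the massless one at every nonzero $u$, it cannot attain the
  common value.
\<close>

subsection \<open>Scaling, the Fourier kernel and the Gaussian\<close>

text \<open>The transform on \<open>L^2\<close> is a chosen limit: its existence rests on a
  completeness argument, and identities about it hold only almost everywhere. Fourier inversion is
  never established. Where it would be expected, in the frequency splitting, the low frequency part
  is an explicit integral, and its distance to \<open>u\<close> is computed by expanding squares,
  which takes only Plancherel and the multiplication formula.

  The cut-off A(t) comes from requiring that the Cauchy-Schwarz bound, of order A^((N-2s)/2) K^(1/2)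
  with K the integral of |\<xi>|^(2s) times the squared modulus of the transform, equal t/2. After
  the exchange of integrals each frequency carries the weight |\<xi>|^((N-2s)(p-2)/2), and this is
  |\<xi>|^(2s) exactly when p is the critical exponent. The constant is not optimised, since only
  its positivity enters the comparison of the infima.

  Both infima run over the same massive space. Hence the integrand of mass m is integrable for every
  competitor of S and dominates the passage to mass zero.\<close>

lemma integrable_lborel_affine:
  fixes f :: "'a::euclidean_space \<Rightarrow> 'b::{banach, second_countable_topology}"
  assumes f: "integrable lborel f" and c: "c \<noteq> 0"
  shows "integrable lborel (\<lambda>x. f (t + c *\<^sub>R x))"
proof -
  have [measurable]: "f \<in> borel_measurable borel"
    using f by auto
  have "integrable (density (distr lborel borel (\<lambda>x. t + c *\<^sub>R x)) (\<lambda>_. \<bar>c\<bar> ^ DIM('a))) f"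
    using f lborel_affine[OF c, of t] by simp
  then have "integrable lborel (\<lambda>x. \<bar>c\<bar> ^ DIM('a) *\<^sub>R f (t + c *\<^sub>R x))"
    by (simp add: integrable_density integrable_distr_eq)
  then have "integrable lborel (\<lambda>x. inverse (\<bar>c\<bar> ^ DIM('a)) *\<^sub>R (\<bar>c\<bar> ^ DIM('a) *\<^sub>R f (t + c *\<^sub>R x)))"
    by (rule integrable_scaleR_right)
  then show ?thesis
    using c by simp
qed

text \<open>When \<open>f\<close> is not integrable, neither is its affine pullback, and both sides
  are the default value \<open>0\<close>; the formula can be applied before integrability is
  known.\<close>

lemma integral_lborel_affine:
  fixes f :: "'a::euclidean_space \<Rightarrow> 'b::{banach, second_countable_topology}"
  assumes f[measurable]: "f \<in> borel_measurable borel" and c: "c \<noteq> 0"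
  shows "(LINT x|lborel. f x) = \<bar>c\<bar> ^ DIM('a) *\<^sub>R (LINT x|lborel. f (t + c *\<^sub>R x))"
  by (subst lborel_affine[OF c, of t]) (simp add: integral_density integral_distr)

definition fourier_kernel :: "'a::euclidean_space \<Rightarrow> 'a \<Rightarrow> complex" where
  "fourier_kernel x \<xi> = exp (- (2 * complex_of_real pi * \<i> * complex_of_real (x \<bullet> \<xi>)))"

lemma fourier_kernel_cis: "fourier_kernel x \<xi> = cis (- (2 * pi * (x \<bullet> \<xi>)))"
  by (simp add: fourier_kernel_def cis_conv_exp mult_ac)

lemma norm_fourier_kernel [simp]: "norm (fourier_kernel x \<xi>) = 1"
  by (simp add: fourier_kernel_cis)

lemma fourier_kernel_commute: "fourier_kernel x \<xi> = fourier_kernel \<xi> x"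
  by (simp add: fourier_kernel_def inner_commute)

lemma fourier_kernel_scaleR: "fourier_kernel (c *\<^sub>R x) \<xi> = fourier_kernel x (c *\<^sub>R \<xi>)"
  by (simp add: fourier_kernel_def)

lemma fourier_kernel_diff: "fourier_kernel (x - y) \<xi> = fourier_kernel x \<xi> * cnj (fourier_kernel y \<xi>)"
  by (simp add: fourier_kernel_cis cis_cnj cis_mult inner_diff_left algebra_simps)

lemma continuous_on_fourier_kernel [continuous_intros]:
  assumes "continuous_on A f" "continuous_on A g"
  shows "continuous_on A (\<lambda>x. fourier_kernel (f x) (g x))"
  unfolding fourier_kernel_def by (intro continuous_intros assms)

lemma measurable_fourier_kernel [measurable (raw)]:
  fixes f g :: "'b \<Rightarrow> 'a::euclidean_space"
  assumes [measurable]: "f \<in> borel_measurable M" "g \<in> borel_measurable M"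
  shows "(\<lambda>x. fourier_kernel (f x) (g x)) \<in> borel_measurable M"
proof -
  have "(\<lambda>p. fourier_kernel (fst p) (snd p) :: complex) \<in> borel_measurable (borel :: ('a \<times> 'a) measure)"
    by (intro borel_measurable_continuous_onI continuous_intros)
  then have "(\<lambda>p. fourier_kernel (fst p) (snd p) :: complex) \<in> borel_measurable (borel \<Otimes>\<^sub>M (borel :: 'a measure))"
    by (simp add: borel_prod)
  from measurable_compose[OF measurable_Pair[OF assms] this] show ?thesis by simp
qed

lemma fourier_integral_alt:
  "fourier_integral f \<xi> = (LINT x|lborel. fourier_kernel x \<xi> * f x)"
  by (simp add: fourier_integral_def fourier_kernel_def)

lemma integrable_fourier_kernel_mult:
  assumes "integrable lborel f"
  shows "integrable lborel (\<lambda>x. fourier_kernel x \<xi> * f x)"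
  by (rule Bochner_Integration.integrable_bound[OF assms])
     (use assms in \<open>auto simp: norm_mult\<close>)

lemma fourier_integral_measurable [measurable (raw)]:
  fixes f :: "'a::euclidean_space \<Rightarrow> complex"
  assumes [measurable]: "f \<in> borel_measurable borel"
  shows "fourier_integral f \<in> borel_measurable borel"
proof -
  have "(\<lambda>\<xi>. LINT x|lborel. fourier_kernel x \<xi> * f x) \<in> borel_measurable (borel :: 'a measure)"
    by measurable
  then show ?thesis by (simp add: fourier_integral_alt[abs_def])
qed

lemma norm_fourier_integral_le:
  assumes "integrable lborel f"
  shows "norm (fourier_integral f \<xi>) \<le> (LINT x|lborel. norm (f x))"
  unfolding fourier_integral_alt
  by (rule order_trans[OF integral_norm_bound]) (simp add: norm_mult)

lemma fourier_integral_diff: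
  assumes "integrable lborel f" "integrable lborel g"
  shows "fourier_integral (\<lambda>x. f x - g x) \<xi> = fourier_integral f \<xi> - fourier_integral g \<xi>"
  unfolding fourier_integral_alt
  by (simp add: right_diff_distrib integrable_fourier_kernel_mult assms)

lemma fourier_integral_scale:
  fixes f :: "'a::euclidean_space \<Rightarrow> complex"
  assumes [measurable]: "f \<in> borel_measurable borel" and c: "c > 0"
  shows "fourier_integral (\<lambda>x. f (c *\<^sub>R x)) \<xi> = fourier_integral f (\<xi> /\<^sub>R c) / of_real (c ^ DIM('a))"
proof -
  have "fourier_integral f (\<xi> /\<^sub>R c) =
      \<bar>c\<bar> ^ DIM('a) *\<^sub>R (LINT x|lborel. fourier_kernel (0 + c *\<^sub>R x) (\<xi> /\<^sub>R c) * f (0 + c *\<^sub>R x))"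
    unfolding fourier_integral_alt by (rule integral_lborel_affine) (use c in auto)
  also have "\<dots> = c ^ DIM('a) *\<^sub>R fourier_integral (\<lambda>x. f (c *\<^sub>R x)) \<xi>"
    using c by (simp add: fourier_integral_alt fourier_kernel_scaleR)
  finally show ?thesis
    using c by (simp add: scaleR_conv_of_real)
qed

text \<open>Lebesgue measure on \<open>'a\<close> is the image of a finite product measure indexed
  by \<open>Basis\<close>, so the integral of a product of functions of single coordinates
  factors.\<close>

lemma integral_prod_Basis:
  fixes F :: "'a::euclidean_space \<Rightarrow> real \<Rightarrow> 'b::{real_normed_field, banach, second_countable_topology}"
  assumes F: "\<And>b. b \<in> Basis \<Longrightarrow> integrable lborel (F b)"
  shows "integrable lborel (\<lambda>x. \<Prod>b\<in>Basis. F b (x \<bullet> b))"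
    and "(LINT x|lborel. (\<Prod>b\<in>Basis. F b (x \<bullet> b))) = (\<Prod>b\<in>Basis. (LINT t|lborel. F b t))"
proof -
  interpret product_sigma_finite "\<lambda>_::'a. lborel :: real measure" ..
  have meas[measurable]: "F b \<in> borel_measurable borel" if "b \<in> Basis" for b
    using borel_measurable_integrable[OF F[OF that]] by simp
  have m: "(\<lambda>x. \<Prod>b\<in>Basis. F b (x \<bullet> b)) \<in> borel_measurable borel"
    by measurable
  have eq: "(\<Prod>b\<in>Basis. F b ((\<Sum>c\<in>Basis. f c *\<^sub>R c) \<bullet> b)) = (\<Prod>b\<in>Basis. F b (f b))" for f :: "'a \<Rightarrow> real"
    by (intro prod.cong refl) simp
  show "integrable lborel (\<lambda>x. \<Prod>b\<in>Basis. F b (x \<bullet> b))"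
    unfolding lborel_eq[where 'a='a]
    by (subst integrable_distr_eq) (use m product_integrable_prod[OF finite_Basis F] in \<open>simp_all add: eq\<close>)
  show "(LINT x|lborel. (\<Prod>b\<in>Basis. F b (x \<bullet> b))) = (\<Prod>b\<in>Basis. (LINT t|lborel. F b t))"
    unfolding lborel_eq[where 'a='a]
    by (subst integral_distr) (use m product_integral_prod[OF finite_Basis F] in \<open>simp_all add: eq\<close>)
qed

section \<open>The Gaussian and its Fourier transform\<close>

definition gauss :: "'a::euclidean_space \<Rightarrow> real" where
  "gauss x = exp (- (norm x)\<^sup>2 / 2)"

text \<open>This is the Fourier transform of \<open>gauss\<close>. The normalisation
  \<open>gauss 0 = 1\<close> suits the regularisation, where
  \<open>gauss (e *\<^sub>R \<xi>)\<close> tends to 1 as \<open>e\<close> tends to 0; the factor in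
  front is the integral of \<open>gauss\<close>.\<close>

definition gauss_hat :: "'a::euclidean_space \<Rightarrow> real" where
  "gauss_hat x = sqrt (2 * pi) ^ DIM('a) * gauss ((2 * pi) *\<^sub>R x)"

lemma gauss_pos [simp]: "gauss x > 0" and gauss_nonneg [simp]: "gauss x \<ge> 0"
  and gauss_le_1 [simp]: "gauss x \<le> 1" and gauss_zero [simp]: "gauss 0 = 1"
  by (simp_all add: gauss_def)

lemma gauss_hat_nonneg [simp]: "gauss_hat x \<ge> 0"
  by (simp add: gauss_hat_def)

lemma continuous_on_gauss [continuous_intros]: "continuous_on A gauss"
  unfolding gauss_def by (intro continuous_intros) auto

lemma measurable_gauss [measurable]: "gauss \<in> borel_measurable borel"
  by (intro borel_measurable_continuous_onI continuous_on_gauss)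

lemma measurable_gauss_hat [measurable]: "gauss_hat \<in> borel_measurable borel"
  unfolding gauss_hat_def by measurable

lemma gauss_prod: "gauss (x::'a::euclidean_space) = (\<Prod>b\<in>Basis. gauss (x \<bullet> b))"
proof -
  have "(norm x)\<^sup>2 = (\<Sum>b\<in>Basis. (x \<bullet> b)\<^sup>2)"
    by (subst power2_norm_eq_inner, subst euclidean_inner) (simp add: power2_eq_square)
  then show ?thesis
    by (simp add: gauss_def exp_sum[symmetric] sum_negf sum_divide_distrib)
qed

lemma integrable_gauss_real: "integrable lborel (gauss :: real \<Rightarrow> real)"
proof -
  have "integrable lborel (\<lambda>x. sqrt (2 * pi) * std_normal_density x)"
    using integrable_normal_density[of 1 0] by simp
  then show ?thesis
    by (simp add: std_normal_density_def gauss_def[abs_def])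
qed

text \<open>Up to the factor \<open>sqrt (2 * pi)\<close> the left side is the characteristic
  function of the standard normal distribution.\<close>

lemma integral_gauss_real:
  "(LINT x|lborel. iexp (s * x) * gauss x) = sqrt (2 * pi) * gauss s"
proof -
  have "(LINT x|lborel. iexp (s * x) * gauss x)
      = (LINT x|lborel. complex_of_real (sqrt (2 * pi)) * (std_normal_density x *\<^sub>R iexp (s * x)))"
    by (intro Bochner_Integration.integral_cong)
       (auto simp: std_normal_density_def gauss_def scaleR_conv_of_real)
  also have "\<dots> = sqrt (2 * pi) * (LINT x|lborel. std_normal_density x *\<^sub>R iexp (s * x))"
    by (rule integral_mult_right_zero)
  also have "\<dots> = sqrt (2 * pi) * char std_normal_distribution s"
    by (simp add: char_def integral_density)
  also have "\<dots> = sqrt (2 * pi) * gauss s"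
    by (simp add: char_std_normal_distribution gauss_def)
  finally show ?thesis .
qed

lemma integrable_gauss [simp, intro]: "integrable lborel (gauss :: 'a::euclidean_space \<Rightarrow> real)"
proof -
  have "integrable lborel (\<lambda>x::'a. \<Prod>b\<in>Basis. gauss (x \<bullet> b))"
    by (intro integral_prod_Basis integrable_gauss_real)
  then show ?thesis
    by (simp add: gauss_prod[symmetric])
qed

text \<open>Kernel and Gaussian are both products over the coordinates, which reduces the claim to
  dimension one. The \<open>2 * pi\<close> in the kernel explains the dilation in
  \<open>gauss_hat\<close>.\<close>

lemma fourier_integral_gauss:
  fixes z :: "'a::euclidean_space"
  shows "fourier_integral (\<lambda>x. of_real (gauss x)) z = of_real (gauss_hat z)"
proof -
  define F where "F b t = iexp (- (2 * pi * (z \<bullet> b)) * t) * gauss t" for b :: 'a and t :: real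
  have F: "integrable lborel (F b)" for b
    by (rule Bochner_Integration.integrable_bound[OF integrable_gauss_real])
       (auto simp: norm_mult F_def[abs_def])
  have eq: "fourier_kernel x z * of_real (gauss x) = (\<Prod>b\<in>Basis. F b (x \<bullet> b))" for x
  proof -
    have "x \<bullet> z = (\<Sum>b\<in>Basis. (x \<bullet> b) * (z \<bullet> b))"
      by (rule euclidean_inner)
    then have "fourier_kernel x z = (\<Prod>b\<in>Basis. iexp (- (2 * pi * (z \<bullet> b)) * (x \<bullet> b)))"
      unfolding fourier_kernel_def
      by (subst exp_sum[symmetric]) (simp_all add: sum_negf sum_distrib_left mult_ac)
    moreover have "complex_of_real (gauss x) = (\<Prod>b\<in>Basis. of_real (gauss (x \<bullet> b)))"
      by (subst gauss_prod) simp
    ultimately show ?thesis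
      unfolding F_def by (simp only: prod.distrib)
  qed
  have "fourier_integral (\<lambda>x. of_real (gauss x)) z = (\<Prod>b\<in>Basis. (LINT t|lborel. F b t))"
    unfolding fourier_integral_alt eq by (rule integral_prod_Basis[OF F])
  also have "\<dots> = (\<Prod>b\<in>Basis. complex_of_real (sqrt (2 * pi) * gauss (((2 * pi) *\<^sub>R z) \<bullet> b)))"
    unfolding F_def integral_gauss_real by (intro prod.cong refl) (simp add: gauss_def)
  also have "\<dots> = of_real (gauss_hat z)"
    by (simp add: gauss_hat_def prod.distrib gauss_prod[of "(2 * pi) *\<^sub>R z"])
  finally show ?thesis .
qed

lemma integrable_gauss_hat [simp, intro]: "integrable lborel (gauss_hat :: 'a::euclidean_space \<Rightarrow> real)"
  unfolding gauss_hat_def using integrable_lborel_affine[of "gauss :: 'a \<Rightarrow> real" "2 * pi" 0] by simp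

text \<open>The integral of \<open>gauss\<close> is computed in two ways, as the value of its
  transform at 0 and by dilation with \<open>2 * pi\<close>; comparing the constants leaves 1. This
  mass one is why the Gaussian average of the autocorrelation tends to its value at 0.\<close>

lemma integral_gauss_hat: "(LINT x|lborel. gauss_hat (x::'a::euclidean_space)) = 1"
proof -
  let ?I = "LINT x|lborel. gauss (x::'a)"
  have I: "?I = sqrt (2 * pi) ^ DIM('a)"
    using fourier_integral_gauss[of "0::'a"] by (simp add: fourier_integral_def gauss_hat_def flip: of_real_power)
  have "?I = (2 * pi) ^ DIM('a) * (LINT x|lborel. gauss ((2 * pi) *\<^sub>R (x::'a)))"
    using integral_lborel_affine[of "gauss :: 'a \<Rightarrow> real" "2 * pi" 0] by simp
  also have "(2 * pi) ^ DIM('a) = sqrt (2 * pi) ^ DIM('a) * sqrt (2 * pi) ^ DIM('a)"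
    by (subst power_mult_distrib[symmetric]) simp
  also have "sqrt (2 * pi) ^ DIM('a) * sqrt (2 * pi) ^ DIM('a) * (LINT x|lborel. gauss ((2 * pi) *\<^sub>R (x::'a)))
     = sqrt (2 * pi) ^ DIM('a) * (LINT x|lborel. gauss_hat (x::'a))"
    by (simp add: gauss_hat_def)
  finally show ?thesis
    unfolding I by simp
qed

subsection \<open>Square integrable functions\<close>

text \<open>The squared norm, without the root. As a Bochner integral it is \<open>0\<close> on
  functions that are not square integrable, so a small value is meaningful only together with
  \<open>square_integrable\<close>.\<close>

definition l2 :: "('a::euclidean_space \<Rightarrow> 'b::real_normed_vector) \<Rightarrow> real" where
  "l2 f = (LINT x|lborel. (norm (f x))\<^sup>2)"

lemma l2_nonneg [simp]: "l2 f \<ge> 0"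
  by (simp add: l2_def)

lemma l2_uminus_diff: "l2 (\<lambda>x. f x - g x) = l2 (\<lambda>x. g x - f x)"
  by (simp add: l2_def norm_minus_commute)

lemma square_integrable_iff_nn_integral:
  "square_integrable f \<longleftrightarrow>
     f \<in> borel_measurable borel \<and> (\<integral>\<^sup>+x. ennreal ((norm (f x))\<^sup>2) \<partial>lborel) < \<infinity>"
  by (auto simp: square_integrable_def integrable_iff_bounded)

lemma square_integrable_measurable [measurable_dest]:
  "square_integrable f \<Longrightarrow> f \<in> borel_measurable borel"
  by (simp add: square_integrable_def)

lemma square_integrable_integrable:
  "square_integrable f \<Longrightarrow> integrable lborel (\<lambda>x. (norm (f x))\<^sup>2)"
  by (simp add: square_integrable_def)

lemma nn_integral_eq_l2:
  "square_integrable f \<Longrightarrow> (\<integral>\<^sup>+x. ennreal ((norm (f x))\<^sup>2) \<partial>lborel) = ennreal (l2 f)"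
  unfolding l2_def by (intro nn_integral_eq_integral) (auto dest: square_integrable_integrable)

text \<open>The substitute for the triangle inequality at the level of squares. The factor 2 is
  harmless in limits and spares square roots throughout.\<close>

lemma norm_diff_power2_le: "(norm (a - b))\<^sup>2 \<le> 2 * (norm a)\<^sup>2 + 2 * (norm (b :: 'a::real_normed_vector))\<^sup>2"
proof -
  have "(norm (a - b))\<^sup>2 \<le> (norm a + norm b)\<^sup>2"
    by (intro power_mono norm_triangle_ineq4) auto
  also have "\<dots> \<le> 2 * (norm a)\<^sup>2 + 2 * (norm b)\<^sup>2"
    using sum_squares_ge_zero[of "norm a - norm b" 0] by (simp add: power2_eq_square algebra_simps)
  finally show ?thesis .
qed

lemma square_integrable_mono:
  fixes f :: "'a::euclidean_space \<Rightarrow> 'b::real_normed_vector" and g :: "'a \<Rightarrow> 'c::real_normed_vector"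
  assumes "square_integrable g" "f \<in> borel_measurable borel" "\<And>x. norm (f x) \<le> norm (g x)"
  shows "square_integrable f"
  unfolding square_integrable_def
proof (intro conjI)
  show "integrable lborel (\<lambda>x. (norm (f x))\<^sup>2)"
    by (rule Bochner_Integration.integrable_bound[OF square_integrable_integrable[OF assms(1)]])
       (use assms in \<open>auto intro!: power_mono\<close>)
qed (use assms in simp)

lemma
  fixes f g :: "'a::euclidean_space \<Rightarrow> 'b::{real_normed_vector, second_countable_topology}"
  assumes "square_integrable f" "square_integrable g"
  shows square_integrable_diff: "square_integrable (\<lambda>x. f x - g x)"
    and l2_diff_le: "l2 (\<lambda>x. f x - g x) \<le> 2 * (l2 f + l2 g)"
proof -
  have [measurable]: "f \<in> borel_measurable borel" "g \<in> borel_measurable borel"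
    using assms by (auto dest: square_integrable_measurable)
  have int: "integrable lborel (\<lambda>x. 2 * (norm (f x))\<^sup>2 + 2 * (norm (g x))\<^sup>2)"
    using assms by (simp add: square_integrable_integrable)
  have int': "integrable lborel (\<lambda>x. (norm (f x - g x))\<^sup>2)"
    by (rule Bochner_Integration.integrable_bound[OF int]) (auto simp: norm_diff_power2_le)
  then show "square_integrable (\<lambda>x. f x - g x)"
    by (simp add: square_integrable_def)
  have "l2 (\<lambda>x. f x - g x) \<le> (LINT x|lborel. 2 * (norm (f x))\<^sup>2 + 2 * (norm (g x))\<^sup>2)"
    unfolding l2_def by (rule integral_mono[OF int' int norm_diff_power2_le])
  also have "\<dots> = 2 * (l2 f + l2 g)"
    unfolding l2_def using assms by (simp add: square_integrable_integrable)
  finally show "l2 (\<lambda>x. f x - g x) \<le> 2 * (l2 f + l2 g)" .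
qed

lemma square_integrable_mult:
  fixes f g :: "'a::euclidean_space \<Rightarrow> 'b::{real_normed_field, banach, second_countable_topology}"
  assumes "square_integrable f" "square_integrable g"
  shows "integrable lborel (\<lambda>x. f x * g x)"
proof (rule Bochner_Integration.integrable_bound)
  show "integrable lborel (\<lambda>x. (norm (f x))\<^sup>2 + (norm (g x))\<^sup>2)"
    using assms by (auto dest: square_integrable_integrable)
  have "norm (f x) * norm (g x) \<le> (norm (f x))\<^sup>2 + (norm (g x))\<^sup>2" for x
    using sum_squares_bound[of "norm (f x)" "norm (g x)"] mult_nonneg_nonneg[OF norm_ge_zero norm_ge_zero, of "f x" "g x"]
    unfolding mult.assoc by linarith
  then show "AE x in lborel. norm (f x * g x) \<le> norm ((norm (f x))\<^sup>2 + (norm (g x))\<^sup>2)"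
    by (simp add: norm_mult)
qed (use assms in \<open>auto dest: square_integrable_measurable\<close>)

lemma Cauchy_Schwarz_square_integrable:
  fixes f g :: "'a::euclidean_space \<Rightarrow> 'b::{real_normed_field, banach, second_countable_topology}"
  assumes f: "square_integrable f" and g: "square_integrable g"
  shows "(LINT x|lborel. norm (f x * g x))\<^sup>2 \<le> l2 f * l2 g"
proof -
  define Z where "Z = (LINT x|lborel. norm (f x) * norm (g x))"
  have Z: "integrable lborel (\<lambda>x. norm (f x) * norm (g x))"
    using integrable_norm[OF square_integrable_mult[OF f g]] by (simp add: norm_mult)
  note ints = Z square_integrable_integrable[OF f] square_integrable_integrable[OF g]
  \<comment> \<open>The square of \<open>a * norm (f x) - b * norm (g x)\<close> has nonnegative
    integral. The pairs \<open>(Z, l2 f)\<close> and \<open>(l2 g, Z)\<close> yield the inequality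
    times \<open>l2 f\<close> or \<open>l2 g\<close>; when both of these vanish,
    \<open>a = b = 1\<close> forces \<open>Z\<close> to vanish.\<close>
  have key: "2 * a * b * Z \<le> a\<^sup>2 * l2 f + b\<^sup>2 * l2 g" for a b
  proof -
    have "0 \<le> (LINT x|lborel. (a * norm (f x) - b * norm (g x))\<^sup>2)"
      by simp
    also have "\<dots> = (LINT x|lborel. a\<^sup>2 * (norm (f x))\<^sup>2 + b\<^sup>2 * (norm (g x))\<^sup>2 - (2 * a * b) * (norm (f x) * norm (g x)))"
      by (intro Bochner_Integration.integral_cong) (auto simp: power2_eq_square algebra_simps)
    also have "\<dots> = a\<^sup>2 * l2 f + b\<^sup>2 * l2 g - 2 * a * b * Z"
      using ints by (simp add: l2_def Z_def)
    finally show ?thesis by simp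
  qed
  have "Z\<^sup>2 \<le> l2 f * l2 g"
  proof (cases "l2 f = 0 \<and> l2 g = 0")
    case True
    moreover have "Z \<ge> 0"
      unfolding Z_def by (intro Bochner_Integration.integral_nonneg) auto
    ultimately show ?thesis using key[of 1 1] by simp
  next
    case False
    then consider "l2 f > 0" | "l2 g > 0"
      using l2_nonneg[of f] l2_nonneg[of g] by linarith
    then show ?thesis
    proof cases
      case 1
      have "l2 f * Z\<^sup>2 \<le> l2 f * (l2 f * l2 g)"
        using key[of Z "l2 f"] by (simp add: power2_eq_square algebra_simps)
      with 1 show ?thesis by simp
    next
      case 2
      have "l2 g * Z\<^sup>2 \<le> l2 g * (l2 f * l2 g)"
        using key[of "l2 g" Z] by (simp add: power2_eq_square algebra_simps)
      with 2 show ?thesis by simp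
    qed
  qed
  then show ?thesis
    by (simp add: Z_def norm_mult)
qed

lemma norm_integral_mult_le:
  fixes f g :: "'a::euclidean_space \<Rightarrow> 'b::{real_normed_field, banach, second_countable_topology}"
  assumes f: "square_integrable f" and g: "square_integrable g"
  shows "norm (LINT x|lborel. f x * g x) \<le> sqrt (l2 f * l2 g)"
  using integral_norm_bound[of lborel "\<lambda>x. f x * g x"]
    real_le_rsqrt[OF Cauchy_Schwarz_square_integrable[OF f g]]
  by linarith

lemma tendsto_integral_mult_l2:
  fixes F :: "'i \<Rightarrow> 'a::euclidean_space \<Rightarrow> 'b::{real_normed_field, banach, second_countable_topology}"
  assumes F: "\<And>i. square_integrable (F i)" and g: "square_integrable g" and h: "square_integrable h"
    and lim: "((\<lambda>i. l2 (\<lambda>x. F i x - g x)) \<longlongrightarrow> 0) A"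
  shows "((\<lambda>i. LINT x|lborel. F i x * h x) \<longlongrightarrow> (LINT x|lborel. g x * h x)) A"
proof (rule LIM_zero_cancel, rule Lim_null_comparison)
  show "\<forall>\<^sub>F i in A. norm ((LINT x|lborel. F i x * h x) - (LINT x|lborel. g x * h x))
      \<le> sqrt (l2 (\<lambda>x. F i x - g x) * l2 h)"
  proof (rule always_eventually, rule allI)
    fix i
    have "(LINT x|lborel. F i x * h x) - (LINT x|lborel. g x * h x) = (LINT x|lborel. (F i x - g x) * h x)"
      using square_integrable_mult[OF F[of i] h] square_integrable_mult[OF g h]
      by (simp add: left_diff_distrib)
    then show "norm ((LINT x|lborel. F i x * h x) - (LINT x|lborel. g x * h x))
        \<le> sqrt (l2 (\<lambda>x. F i x - g x) * l2 h)"
      using norm_integral_mult_le[OF square_integrable_diff[OF F[of i] g] h] by simp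
  qed
  show "((\<lambda>i. sqrt (l2 (\<lambda>x. F i x - g x) * l2 h)) \<longlongrightarrow> 0) A"
    by (rule tendsto_eq_rhs[OF tendsto_real_sqrt[OF tendsto_mult_right[OF lim]]]) simp
qed

lemma square_integrable_cnj:
  "square_integrable f \<Longrightarrow> square_integrable (\<lambda>x. cnj (f x))"
  by (rule square_integrable_mono[of f])
     (auto intro!: borel_measurable_continuous_on[where f=cnj] continuous_intros dest: square_integrable_measurable)

text \<open>With this expansion, equality of norms and of one pairing is enough to transfer a
  distance from the space side to the frequency side.\<close>

lemma l2_diff_expand:
  fixes f g :: "'a::euclidean_space \<Rightarrow> complex"
  assumes f: "square_integrable f" and g: "square_integrable g"
  shows "l2 (\<lambda>x. f x - g x) = l2 f + l2 g - 2 * Re (LINT x|lborel. f x * cnj (g x))"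
proof -
  have e: "(norm (a - b))\<^sup>2 = (norm a)\<^sup>2 + (norm b)\<^sup>2 - 2 * Re (a * cnj b)" for a b :: complex
    unfolding cmod_power2 by (simp add: power2_eq_square algebra_simps)
  have i: "integrable lborel (\<lambda>x. f x * cnj (g x))"
    by (rule square_integrable_mult[OF f square_integrable_cnj[OF g]])
  have "Re (LINT x|lborel. f x * cnj (g x)) = (LINT x|lborel. Re (f x * cnj (g x)))"
    by (rule integral_Re[OF i, symmetric])
  then show ?thesis
    unfolding l2_def e using i f g
    by (simp add: square_integrable_integrable integrable_Re del: complex_cnj_mult times_complex.sel)
qed

text \<open>Solving the expansion for \<open>l2 (F i)\<close> leaves a distance that tends to 0 and
  a pairing that is continuous, so the norms converge as well.\<close>

lemma tendsto_l2:
  fixes F :: "'i \<Rightarrow> 'a::euclidean_space \<Rightarrow> complex"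
  assumes F: "\<And>i. square_integrable (F i)" and g: "square_integrable g"
    and lim: "((\<lambda>i. l2 (\<lambda>x. F i x - g x)) \<longlongrightarrow> 0) A"
  shows "((\<lambda>i. l2 (F i)) \<longlongrightarrow> l2 g) A"
proof -
  let ?h = "\<lambda>x. cnj (g x)"
  have "l2 (F i) = l2 (\<lambda>x. F i x - g x) - l2 g + 2 * Re (LINT x|lborel. F i x * ?h x)" for i
    using l2_diff_expand[OF F[of i] g] by simp
  moreover have "((\<lambda>i. l2 (\<lambda>x. F i x - g x) - l2 g + 2 * Re (LINT x|lborel. F i x * ?h x))
      \<longlongrightarrow> 0 - l2 g + 2 * Re (LINT x|lborel. g x * ?h x)) A"
    by (intro tendsto_intros lim tendsto_integral_mult_l2 F g square_integrable_cnj)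
  moreover have "0 - l2 g + 2 * Re (LINT x|lborel. g x * ?h x) = l2 g"
    using l2_diff_expand[OF g g] by (simp add: l2_def)
  ultimately show ?thesis by simp
qed

lemma square_integrable_translate:
  fixes f :: "'a::euclidean_space \<Rightarrow> 'b::real_normed_vector"
  assumes "square_integrable f"
  shows "square_integrable (\<lambda>x. f (x - w))" "l2 (\<lambda>x. f (x - w)) = l2 f"
proof -
  have [measurable]: "f \<in> borel_measurable borel"
    using assms by (auto dest: square_integrable_measurable)
  show "square_integrable (\<lambda>x. f (x - w))"
    using integrable_lborel_affine[OF square_integrable_integrable[OF assms], of 1 "-w"]
    by (simp add: square_integrable_def)
  show "l2 (\<lambda>x. f (x - w)) = l2 f"
    unfolding l2_def
    by (subst (2) integral_lborel_affine[of _ 1 "-w"]) auto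
qed

subsection \<open>Continuity of translations\<close>

lemma square_integrable_bounded_support:
  fixes f :: "'a::euclidean_space \<Rightarrow> 'b::real_normed_vector"
  assumes [measurable]: "f \<in> borel_measurable borel"
    and B: "\<And>x. norm (f x) \<le> B" and r: "\<And>x. norm x > r \<Longrightarrow> f x = 0"
  shows "square_integrable f"
  unfolding square_integrable_def
proof
  have "integrable lborel (\<lambda>x. B\<^sup>2 * indicator (cball 0 r) (x::'a))"
    by (intro integrable_mult_right integrable_real_indicator emeasure_lborel_cball_finite) auto
  then show "integrable lborel (\<lambda>x. (norm (f x))\<^sup>2)"
    by (rule Bochner_Integration.integrable_bound)
       (use B r in \<open>auto simp: indicator_def not_le intro!: power_mono\<close>)
qed simp

text \<open>On the ball, which has finite measure, a \<le> a^2 + 1 gives integrability. Through this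
  the transform of a ball truncation is a genuine integral and not a default value.\<close>

lemma square_integrable_bounded_support_integrable:
  fixes f :: "'a::euclidean_space \<Rightarrow> 'b::{banach, second_countable_topology}"
  assumes f: "square_integrable f" and r: "\<And>x. norm x > r \<Longrightarrow> f x = 0"
  shows "integrable lborel f"
proof -
  have [measurable]: "f \<in> borel_measurable borel"
    using f by (auto dest: square_integrable_measurable)
  have "integrable lborel (\<lambda>x. (norm (f x))\<^sup>2 + indicator (cball 0 r) x)"
    by (intro Bochner_Integration.integrable_add square_integrable_integrable f integrable_real_indicator
          emeasure_lborel_cball_finite) auto
  then show ?thesis
  proof (rule Bochner_Integration.integrable_bound)
    have "a \<le> a\<^sup>2 + 1" for a :: real
      using zero_le_power2[of "a - 1/2"] by (simp add: power2_eq_square algebra_simps)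
    then show "AE x in lborel. norm (f x) \<le> norm ((norm (f x))\<^sup>2 + indicator (cball 0 r) x)"
      using r by (auto simp: indicator_def not_le)
  qed simp
qed

text \<open>Sequential form of \<open>f (\<cdot> - w) \<longrightarrow> f\<close> in $L^2$ as \<open>w \<longrightarrow> 0\<close>.\<close>

definition translation_continuous :: "('a::euclidean_space \<Rightarrow> complex) \<Rightarrow> bool" where
  "translation_continuous f \<longleftrightarrow>
     (\<forall>w::nat \<Rightarrow> 'a. w \<longlonglongrightarrow> 0 \<longrightarrow> (\<lambda>n. l2 (\<lambda>x. f (x - w n) - f x)) \<longlonglongrightarrow> 0)"

lemma translation_continuous_approx:
  assumes f: "square_integrable f" and h: "\<And>n. square_integrable (h n)"
    and tc: "\<And>n. translation_continuous (h n)"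
    and lim: "(\<lambda>n. l2 (\<lambda>x. f x - h n x)) \<longlonglongrightarrow> 0"
  shows "translation_continuous f"
  unfolding translation_continuous_def
proof (intro allI impI, rule LIMSEQ_I)
  fix w :: "nat \<Rightarrow> 'a" and e :: real
  assume w: "w \<longlonglongrightarrow> 0" and e: "e > 0"
  \<comment> \<open>The two uses of \<open>l2_diff_le\<close> give the bound 2 * (4 * l2 d + l2 of
    the translation difference of h k). With e/16 and e/4 this is below 2 * (e/4 + e/4) = e.
    Translation invariance makes both copies of \<open>d\<close> equally small.\<close>
  obtain k where k: "l2 (\<lambda>x. f x - h k x) < e / 16"
    using order_tendstoD(2)[OF lim, of "e / 16"] e by (auto simp: eventually_sequentially)
  have "\<forall>\<^sub>F n in sequentially. l2 (\<lambda>x. h k (x - w n) - h k x) < e / 4"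
    using order_tendstoD(2)[of _ 0 sequentially "e / 4"] tc[of k] w e
    by (auto simp: translation_continuous_def)
  moreover have "l2 (\<lambda>x. f (x - w n) - f x) < e"
    if n: "l2 (\<lambda>x. h k (x - w n) - h k x) < e / 4" for n
  proof -
    define d where "d = (\<lambda>x. f x - h k x)"
    have d: "square_integrable d"
      unfolding d_def by (rule square_integrable_diff[OF f h])
    note dw = square_integrable_translate[OF d, of "w n"]
    note hw = square_integrable_diff[OF square_integrable_translate(1)[OF h[of k], of "w n"] h[of k]]
    have "l2 (\<lambda>x. f (x - w n) - f x) = l2 (\<lambda>x. (d (x - w n) - d x) - (h k x - h k (x - w n)))"
      by (simp add: d_def)
    also have "\<dots> \<le> 2 * (l2 (\<lambda>x. d (x - w n) - d x) + l2 (\<lambda>x. h k x - h k (x - w n)))"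
      by (intro l2_diff_le square_integrable_diff d dw h square_integrable_translate)
    also have "l2 (\<lambda>x. d (x - w n) - d x) \<le> 2 * (l2 d + l2 d)"
      using l2_diff_le[OF dw(1) d] dw(2) by simp
    also have "l2 d < e / 16"
      using k by (simp add: d_def)
    also have "l2 (\<lambda>x. h k x - h k (x - w n)) < e / 4"
      using n by (subst l2_uminus_diff)
    finally show ?thesis by simp
  qed
  ultimately show "\<exists>N. \<forall>n\<ge>N. norm (l2 (\<lambda>x. f (x - w n) - f x) - 0) < e"
    by (auto simp: eventually_sequentially)
qed

lemma translation_continuous_compact_support:
  fixes h :: "'a::euclidean_space \<Rightarrow> complex"
  assumes h: "continuous_on UNIV h" and B: "\<And>x. norm (h x) \<le> B" and r: "\<And>x. norm x > r \<Longrightarrow> h x = 0"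
  shows "translation_continuous h"
  unfolding translation_continuous_def
proof (intro allI impI)
  fix w :: "nat \<Rightarrow> 'a" assume w: "w \<longlonglongrightarrow> 0"
  have [measurable]: "h \<in> borel_measurable borel"
    by (rule borel_measurable_continuous_onI[OF h])
  \<comment> \<open>A convergent sequence is bounded, so all translates vanish outside the ball of
    radius \<open>r + M\<close>, and one integrable function dominates them.\<close>
  obtain M where M: "\<And>n. norm (w n) \<le> M"
    using convergent_imp_Bseq[of w] w by (auto simp: Bseq_def convergent_def)
  have M0: "M \<ge> 0" using M[of 0] norm_ge_zero[of "w 0"] by linarith
  have "(\<lambda>n. LINT x|lborel. (norm (h (x - w n) - h x))\<^sup>2) \<longlonglongrightarrow> (LINT x|(lborel :: 'a measure). (0::real))"
  proof (rule Bochner_Integration.integral_dominated_convergence[where w = "\<lambda>x. (2 * B)\<^sup>2 * indicator (cball 0 (r + M)) x"])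
    show "integrable lborel (\<lambda>x::'a. (2 * B)\<^sup>2 * indicator (cball 0 (r + M)) x)"
      by (intro integrable_mult_right integrable_real_indicator emeasure_lborel_cball_finite) auto
    show "AE x in lborel. (\<lambda>n. (norm (h (x - w n) - h x))\<^sup>2) \<longlonglongrightarrow> 0"
    proof (rule AE_I2)
      fix x
      have "(\<lambda>n. x - w n) \<longlonglongrightarrow> x - 0"
        by (intro tendsto_intros w)
      then have "(\<lambda>n. h (x - w n)) \<longlonglongrightarrow> h x"
        using h by (intro isCont_tendsto_compose[of _ h]) (auto simp: continuous_on_eq_continuous_at)
      then have "(\<lambda>n. (norm (h (x - w n) - h x))\<^sup>2) \<longlonglongrightarrow> (norm (h x - h x))\<^sup>2"
        by (intro tendsto_intros)
      then show "(\<lambda>n. (norm (h (x - w n) - h x))\<^sup>2) \<longlonglongrightarrow> 0"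
        by simp
    qed
    fix n
    show "AE x in lborel. norm ((norm (h (x - w n) - h x))\<^sup>2) \<le> (2 * B)\<^sup>2 * indicator (cball 0 (r + M)) x"
    proof (rule AE_I2)
      fix x
      show "norm ((norm (h (x - w n) - h x))\<^sup>2) \<le> (2 * B)\<^sup>2 * indicator (cball 0 (r + M)) x"
      proof (cases "norm x \<le> r + M")
        case True
        have "norm (h (x - w n) - h x) \<le> 2 * B"
          using norm_triangle_ineq4[of "h (x - w n)" "h x"] B[of "x - w n"] B[of x] by linarith
        then have "(norm (h (x - w n) - h x))\<^sup>2 \<le> (2 * B)\<^sup>2"
          by (intro power_mono) auto
        with True show ?thesis by simp
      next
        case False
        have "norm x > r" "norm (x - w n) > r"
          using False M0 M[of n] norm_triangle_ineq2[of x "w n"] by linarith+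
        then show ?thesis using r by simp
      qed
    qed
  qed auto
  then show "(\<lambda>n. l2 (\<lambda>x. h (x - w n) - h x)) \<longlonglongrightarrow> 0"
    by (simp add: l2_def)
qed

lemma tendsto_l2_dominated:
  fixes F :: "nat \<Rightarrow> 'a::euclidean_space \<Rightarrow> complex"
  assumes g: "square_integrable g"
    and F[measurable]: "\<And>n. F n \<in> borel_measurable borel"
    and f[measurable]: "f \<in> borel_measurable borel"
    and lim: "AE x in lborel. (\<lambda>n. F n x) \<longlonglongrightarrow> f x"
    and bd: "\<And>n x. norm (f x - F n x) \<le> norm (g x :: 'b::real_normed_vector)"
  shows "(\<lambda>n. l2 (\<lambda>x. f x - F n x)) \<longlonglongrightarrow> 0"
proof -
  have "(\<lambda>n. LINT x|lborel. (norm (f x - F n x))\<^sup>2) \<longlonglongrightarrow> (LINT x|(lborel :: 'a measure). (0::real))"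
  proof (rule Bochner_Integration.integral_dominated_convergence[where w = "\<lambda>x. (norm (g x))\<^sup>2"])
    show "AE x in lborel. (\<lambda>n. (norm (f x - F n x))\<^sup>2) \<longlonglongrightarrow> 0"
      using lim
    proof eventually_elim
      fix x assume "(\<lambda>n. F n x) \<longlonglongrightarrow> f x"
      then have "(\<lambda>n. (norm (f x - F n x))\<^sup>2) \<longlonglongrightarrow> (norm (f x - f x))\<^sup>2"
        by (intro tendsto_intros)
      then show "(\<lambda>n. (norm (f x - F n x))\<^sup>2) \<longlonglongrightarrow> 0" by simp
    qed
  qed (use g bd in \<open>auto intro!: power_mono square_integrable_integrable\<close>)
  then show ?thesis by (simp add: l2_def)
qed

text \<open>A measurable function is an almost everywhere limit of continuous ones, but these may be
  unbounded or have unbounded support. They are cut and clamped so that dominated convergence turns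
  the pointwise limit into an \<open>L^2\<close> limit.\<close>

lemma translation_continuous_bounded:
  fixes f :: "'a::euclidean_space \<Rightarrow> complex"
  assumes meas[measurable]: "f \<in> borel_measurable borel"
    and B: "\<And>x. norm (f x) \<le> B" and r: "\<And>x. norm x > r \<Longrightarrow> f x = 0" and "B > 0"
  shows "translation_continuous f"
proof -
  have "f measurable_on UNIV"
    by (rule lebesgue_measurable_imp_measurable_on) (use meas in \<open>auto intro!: measurable_completion\<close>)
  then obtain N g where N: "negligible N" and g: "\<And>n. continuous_on UNIV (g n)"
    and lim: "\<And>x. x \<notin> N \<Longrightarrow> (\<lambda>n. g n x) \<longlonglongrightarrow> f x"
    by (auto simp: measurable_on_def)
  \<comment> \<open>\<open>cut\<close> is 1 on the ball of radius \<open>r\<close> and 0 outside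
    radius \<open>r + 1\<close>; \<open>clamp\<close> is the radial retraction onto the disc of
    radius \<open>B\<close>. Both are continuous and together leave \<open>f\<close> unchanged, so
    the limit of the modified functions is still \<open>f\<close>.\<close>
  define cut :: "'a \<Rightarrow> real" where "cut x = max 0 (min 1 (r + 1 - norm x))" for x
  define clamp :: "complex \<Rightarrow> complex" where "clamp z = z /\<^sub>R max 1 (norm z / B)" for z
  define h where "h n x = cut x *\<^sub>R clamp (g n x)" for n x
  have cut: "0 \<le> cut x" "cut x \<le> 1" for x
    by (auto simp: cut_def)
  have clamp: "norm (clamp z) \<le> B" for z
    using \<open>B > 0\<close> by (auto simp: clamp_def max_def field_simps)
  have clamp_id: "clamp z = z" if "norm z \<le> B" for z
    using that \<open>B > 0\<close> by (simp add: clamp_def max_def field_simps)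
  have cont_clamp: "continuous_on UNIV clamp"
    unfolding clamp_def using \<open>B > 0\<close> by (intro continuous_intros) (auto simp: max_def)
  have h_cont: "continuous_on UNIV (h n)" for n
    unfolding h_def cut_def
    by (intro continuous_intros continuous_on_compose2[OF cont_clamp g]) auto
  have h_B: "norm (h n x) \<le> B" for n x
    using mult_mono[OF cut(2)[of x] clamp[of "g n x"]] cut(1)[of x] by (simp add: h_def)
  have h_r: "h n x = 0" if "norm x > r + 1" for n x
    using that by (simp add: h_def cut_def)
  have h_meas[measurable]: "h n \<in> borel_measurable borel" for n
    by (rule borel_measurable_continuous_onI[OF h_cont])
  have cut_f: "cut x *\<^sub>R f x = f x" for x
    using r[of x] by (cases "norm x \<le> r") (auto simp: cut_def)
  have "N \<in> null_sets lebesgue"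
    using N by (simp add: negligible_iff_null_sets)
  then have "AE x in lborel. x \<notin> N"
    using AE_not_in AE_completion_iff[of "\<lambda>x. x \<notin> N"] by blast
  then have lim_h: "AE x in lborel. (\<lambda>n. h n x) \<longlonglongrightarrow> f x"
  proof eventually_elim
    case (elim x)
    have "(\<lambda>n. h n x) \<longlonglongrightarrow> cut x *\<^sub>R clamp (f x)"
      unfolding h_def using cont_clamp[unfolded continuous_on_eq_continuous_at[OF open_UNIV]]
      by (intro tendsto_intros isCont_tendsto_compose[OF _ lim[OF elim]]) auto
    then show ?case by (simp add: clamp_id[OF B] cut_f)
  qed
  show ?thesis
  proof (rule translation_continuous_approx)
    show "square_integrable f"
      by (rule square_integrable_bounded_support[OF meas B r])
    show "square_integrable (h n)" for n
      by (rule square_integrable_bounded_support[OF h_meas h_B h_r])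
    show "translation_continuous (h n)" for n
      by (rule translation_continuous_compact_support[OF h_cont h_B h_r])
    show "(\<lambda>n. l2 (\<lambda>x. f x - h n x)) \<longlonglongrightarrow> 0"
    proof (rule tendsto_l2_dominated[OF _ h_meas meas lim_h])
      show "square_integrable (\<lambda>x::'a. 2 * B * indicator (cball 0 (r + 1)) x)"
        by (rule square_integrable_bounded_support[where B = "2 * B" and r = "r + 1"])
           (use \<open>B > 0\<close> in \<open>auto simp: indicator_def\<close>)
      show "norm (f x - h n x) \<le> norm (2 * B * indicator (cball 0 (r + 1)) x)" for n x
        using norm_triangle_ineq4[of "f x" "h n x"] B[of x] h_B[of n x] h_r[of x n] r[of x] \<open>B > 0\<close>
        by (auto simp: indicator_def not_le)
    qed
  qed
qed

lemma translation_continuous_square_integrable: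
  fixes f :: "'a::euclidean_space \<Rightarrow> complex"
  assumes f: "square_integrable f"
  shows "translation_continuous f"
proof -
  have meas[measurable]: "f \<in> borel_measurable borel"
    using f by (auto dest: square_integrable_measurable)
  define h where "h n x = (if norm x \<le> real n \<and> norm (f x) \<le> real n then f x else 0)" for n x
  have [measurable]: "h n \<in> borel_measurable borel" for n
    unfolding h_def by measurable
  have sq: "square_integrable (h n)" for n
    by (rule square_integrable_mono[OF f]) (auto simp: h_def)
  show ?thesis
  proof (rule translation_continuous_approx[OF f sq])
    show "translation_continuous (h n)" for n
      \<comment> \<open>The bound must be positive also for \<open>n = 0\<close>, hence
        \<open>real n + 1\<close>.\<close>
      by (rule translation_continuous_bounded[where B = "real n + 1" and r = "real n"]) (auto simp: h_def)
    have "(\<lambda>n. h n x) \<longlonglongrightarrow> f x" for x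
    proof (rule tendsto_eventually)
      obtain k where "max (norm x) (norm (f x)) \<le> real k"
        using real_arch_simple by blast
      then show "\<forall>\<^sub>F n in sequentially. h n x = f x"
        by (intro eventually_sequentiallyI[of k]) (auto simp: h_def)
    qed
    then show "(\<lambda>n. l2 (\<lambda>x. f x - h n x)) \<longlonglongrightarrow> 0"
      by (intro tendsto_l2_dominated[OF f]) (auto simp: h_def)
  qed
qed

subsection \<open>The Plancherel identity for integrable functions\<close>

lemma integral_reflect_translate:
  fixes g :: "'a::euclidean_space \<Rightarrow> 'b::{banach, second_countable_topology}"
  assumes "g \<in> borel_measurable borel"
  shows "(LINT w|lborel. g (x - w)) = (LINT w|lborel. g w)"
  using integral_lborel_affine[OF assms, of "-1" x] by simp

lemma integrable_reflect_translate:
  fixes g :: "'a::euclidean_space \<Rightarrow> 'b::{banach, second_countable_topology}"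
  assumes "integrable lborel g"
  shows "integrable lborel (\<lambda>w. g (x - w))"
  using integrable_lborel_affine[OF assms, of "-1" x] by simp

text \<open>Fubini together with the symmetry of the kernel in its two arguments. The pairing is
  bilinear, without conjugation, so later uses insert \<open>cnj\<close> by hand.\<close>

lemma fourier_multiplication_formula:
  fixes f h :: "'a::euclidean_space \<Rightarrow> complex"
  assumes f: "integrable lborel f" and h: "integrable lborel h"
  shows "(LINT \<xi>|lborel. fourier_integral f \<xi> * h \<xi>) = (LINT x|lborel. f x * fourier_integral h x)"
proof -
  have [measurable]: "f \<in> borel_measurable borel" "h \<in> borel_measurable borel"
    using f h by auto
  have "integrable (lborel \<Otimes>\<^sub>M lborel) (\<lambda>(x, \<xi>). fourier_kernel x \<xi> * f x * h \<xi>)"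
  proof (rule lborel_pair.Fubini_integrable)
    show "integrable lborel (\<lambda>x. LINT \<xi>|lborel. norm (case (x, \<xi>) of (x, \<xi>) \<Rightarrow> fourier_kernel x \<xi> * f x * h \<xi>))"
      using integrable_mult_left[OF integrable_norm[OF f]] by (simp add: norm_mult)
    show "AE x in lborel. integrable lborel (\<lambda>\<xi>. case (x, \<xi>) of (x, \<xi>) \<Rightarrow> fourier_kernel x \<xi> * f x * h \<xi>)"
      by (intro AE_I2 Bochner_Integration.integrable_bound[OF integrable_mult_right[OF h]])
         (auto simp: norm_mult)
  qed measurable
  from lborel_pair.Fubini_integral[OF this]
  have "(LINT \<xi>|lborel. LINT x|lborel. (fourier_kernel x \<xi> * f x) * h \<xi>)
      = (LINT x|lborel. LINT \<xi>|lborel. f x * (fourier_kernel \<xi> x * h \<xi>))"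
    by (simp add: mult_ac fourier_kernel_commute)
  then show ?thesis
    by (simp only: fourier_integral_alt integral_mult_left_zero integral_mult_right_zero)
qed

definition autocorrelation :: "('a::euclidean_space \<Rightarrow> complex) \<Rightarrow> 'a \<Rightarrow> complex" where
  "autocorrelation f w = (LINT x|lborel. f x * cnj (f (x - w)))"

text \<open>The autocorrelation is the convolution of \<open>f\<close> with its conjugate
  reflection. The kernel at w splits into the kernel at x times the conjugate kernel at x - w, and
  Fubini separates the two factors.\<close>

lemma
  fixes f :: "'a::euclidean_space \<Rightarrow> complex"
  assumes f: "integrable lborel f"
  shows integrable_autocorrelation: "integrable lborel (autocorrelation f)"
    and fourier_integral_autocorrelation:
      "fourier_integral (autocorrelation f) \<xi> = of_real ((norm (fourier_integral f \<xi>))\<^sup>2)"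
proof -
  have [measurable]: "f \<in> borel_measurable borel"
    using f by auto
  have [measurable]: "cnj \<in> borel_measurable borel"
    by (intro borel_measurable_continuous_onI continuous_intros)
  have int: "integrable (lborel \<Otimes>\<^sub>M lborel) (\<lambda>(x, w). f x * cnj (f (x - w)))"
  proof (rule lborel_pair.Fubini_integrable)
    have eq: "(LINT w|lborel. norm (f (x - w))) = (LINT w|lborel. norm (f w))" for x
      by (rule integral_reflect_translate[of "\<lambda>y. norm (f y)"]) simp
    show "integrable lborel (\<lambda>x. LINT w|lborel. norm (case (x, w) of (x, w) \<Rightarrow> f x * cnj (f (x - w))))"
      using integrable_mult_left[OF integrable_norm[OF f]] by (simp add: norm_mult eq)
    show "AE x in lborel. integrable lborel (\<lambda>w. case (x, w) of (x, w) \<Rightarrow> f x * cnj (f (x - w)))"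
      using integrable_mult_right[OF integrable_cnj[OF integrable_reflect_translate[OF f]]] by simp
  qed measurable
  show "integrable lborel (autocorrelation f)"
    using lborel_pair.integrable_snd[OF int] by (simp add: autocorrelation_def[abs_def])
  have int': "integrable (lborel \<Otimes>\<^sub>M lborel) (\<lambda>(x, w). fourier_kernel w \<xi> * (f x * cnj (f (x - w))))"
    by (rule Bochner_Integration.integrable_bound[OF int]) (auto simp: norm_mult)
  have "fourier_integral (autocorrelation f) \<xi>
      = (LINT w|lborel. LINT x|lborel. fourier_kernel w \<xi> * (f x * cnj (f (x - w))))"
    by (simp only: fourier_integral_alt autocorrelation_def integral_mult_right_zero)
  also have "\<dots> = (LINT x|lborel. LINT w|lborel. fourier_kernel w \<xi> * (f x * cnj (f (x - w))))"
    using lborel_pair.Fubini_integral[OF int'] by simp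
  also have "\<dots> = (LINT x|lborel. (fourier_kernel x \<xi> * f x) *
      (LINT w|lborel. cnj (fourier_kernel (x - w) \<xi> * f (x - w))))"
  proof (intro Bochner_Integration.integral_cong refl)
    fix x
    have kernel: "fourier_kernel w \<xi> = fourier_kernel x \<xi> * cnj (fourier_kernel (x - w) \<xi>)" for w
      using fourier_kernel_diff[of x "x - w" \<xi>] by simp
    have "fourier_kernel w \<xi> * (f x * cnj (f (x - w)))
        = (fourier_kernel x \<xi> * f x) * cnj (fourier_kernel (x - w) \<xi> * f (x - w))" for w
      unfolding kernel[of w] by (simp only: complex_cnj_mult mult_ac)
    then show "(LINT w|lborel. fourier_kernel w \<xi> * (f x * cnj (f (x - w)))) = (fourier_kernel x \<xi> * f x) *
      (LINT w|lborel. cnj (fourier_kernel (x - w) \<xi> * f (x - w)))"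
      by (simp only: integral_mult_right_zero)
  qed
  also have "(\<lambda>x. LINT w|lborel. cnj (fourier_kernel (x - w) \<xi> * f (x - w)))
      = (\<lambda>x. cnj (fourier_integral f \<xi>))"
  proof
    fix x
    have "(LINT w|lborel. fourier_kernel (x - w) \<xi> * f (x - w)) = fourier_integral f \<xi>"
      unfolding fourier_integral_alt
      by (rule integral_reflect_translate[of "\<lambda>y. fourier_kernel y \<xi> * f y"]) simp
    then show "(LINT w|lborel. cnj (fourier_kernel (x - w) \<xi> * f (x - w))) = cnj (fourier_integral f \<xi>)"
      by (simp only: Bochner_Integration.integral_cnj)
  qed
  also have "(LINT x|lborel. (fourier_kernel x \<xi> * f x) * cnj (fourier_integral f \<xi>))
      = fourier_integral f \<xi> * cnj (fourier_integral f \<xi>)"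
    by (simp only: fourier_integral_alt integral_mult_left_zero)
  finally show "fourier_integral (autocorrelation f) \<xi> = of_real ((norm (fourier_integral f \<xi>))\<^sup>2)"
    by (simp add: complex_norm_square[symmetric] flip: of_real_power)
qed

text \<open>Expanding the translation difference, with both norms equal to that of \<open>f\<close>,
  turns continuity of translations into continuity of the real part at \<open>w = 0\<close>.\<close>

lemma Re_autocorrelation:
  fixes f :: "'a::euclidean_space \<Rightarrow> complex"
  assumes f: "square_integrable f"
  shows "Re (autocorrelation f w) = l2 f - l2 (\<lambda>x. f (x - w) - f x) / 2"
  using l2_diff_expand[OF f square_integrable_translate(1)[OF f, of w]] square_integrable_translate(2)[OF f, of w]
  by (simp add: autocorrelation_def l2_uminus_diff[of f] diff_divide_distrib)

text \<open>The multiplication formula is applied to the autocorrelation and a dilated Gaussian;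
  substituting x = e w cancels the power of \<open>e\<close>. The left side is real, so the real
  part on the right loses nothing.\<close>

lemma integral_fourier_gauss:
  fixes f :: "'a::euclidean_space \<Rightarrow> complex"
  assumes f: "integrable lborel f" and sq: "square_integrable f" and e: "e > 0"
  shows "(LINT \<xi>|lborel. (norm (fourier_integral f \<xi>))\<^sup>2 * gauss (e *\<^sub>R \<xi>))
     = (LINT w|lborel. Re (autocorrelation f (e *\<^sub>R w)) * gauss_hat w)"
proof -
  let ?H = "autocorrelation f"
  have H: "integrable lborel ?H"
    by (rule integrable_autocorrelation[OF f])
  have [measurable]: "?H \<in> borel_measurable borel"
    using H by auto
  have g: "integrable lborel (\<lambda>\<xi>::'a. complex_of_real (gauss (e *\<^sub>R \<xi>)))"
    using integrable_of_real[OF integrable_lborel_affine[OF integrable_gauss, of e 0]] e by simp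
  have ghat: "fourier_integral (\<lambda>\<xi>::'a. complex_of_real (gauss (e *\<^sub>R \<xi>))) x
      = gauss_hat (x /\<^sub>R e) / e ^ DIM('a)" for x
    using fourier_integral_scale[of "\<lambda>x. complex_of_real (gauss (x::'a))", OF _ e]
    by (simp add: fourier_integral_gauss)
  have "complex_of_real (LINT \<xi>|lborel. (norm (fourier_integral f \<xi>))\<^sup>2 * gauss (e *\<^sub>R \<xi>))
      = (LINT \<xi>|lborel. fourier_integral ?H \<xi> * gauss (e *\<^sub>R \<xi>))"
    unfolding fourier_integral_autocorrelation[OF f]
    by (subst integral_complex_of_real[symmetric]) (simp only: of_real_mult)
  also have "\<dots> = (LINT x|lborel. ?H x * (gauss_hat (x /\<^sub>R e) / e ^ DIM('a)))"
    unfolding fourier_multiplication_formula[OF H g] ghat by simp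
  also have "\<dots> = e ^ DIM('a) *\<^sub>R (LINT w|lborel. ?H (e *\<^sub>R w) * (gauss_hat w / e ^ DIM('a)))"
    using e by (subst integral_lborel_affine[of _ e 0]) auto
  also have "\<dots> = (LINT w|lborel. ?H (e *\<^sub>R w) * gauss_hat w)"
    using e by (simp add: scaleR_conv_of_real)
  finally have eq: "complex_of_real (LINT \<xi>|lborel. (norm (fourier_integral f \<xi>))\<^sup>2 * gauss (e *\<^sub>R \<xi>))
    = (LINT w|lborel. ?H (e *\<^sub>R w) * gauss_hat w)" .
  have bd: "norm (?H w) \<le> l2 f" for w
    using norm_integral_mult_le[OF sq square_integrable_cnj[OF square_integrable_translate(1)[OF sq, of w]]]
      square_integrable_translate(2)[OF sq, of w]
    by (simp add: autocorrelation_def l2_def)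
  have "integrable lborel (\<lambda>w. ?H (e *\<^sub>R w) * gauss_hat w)"
    by (rule Bochner_Integration.integrable_bound[OF integrable_mult_right[OF integrable_gauss_hat, of "l2 f"]])
       (auto simp: norm_mult intro!: mult_right_mono bd)
  from integral_Re[OF this] arg_cong[OF eq, of Re] show ?thesis
    by simp
qed

theorem Plancherel_integrable:
  fixes f :: "'a::euclidean_space \<Rightarrow> complex"
  assumes f: "integrable lborel f" and sq: "square_integrable f"
  shows square_integrable_fourier_integral: "square_integrable (fourier_integral f)"
    and l2_fourier_integral: "l2 (fourier_integral f) = l2 f"
proof -
  define e where "e n = 1 / real (Suc n)" for n
  have e0: "e n > 0" for n by (simp add: e_def)
  have e_dec: "e n \<le> e m" if "m \<le> n" for m n
    using that by (simp add: e_def frac_le)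
  have e_lim: "e \<longlonglongrightarrow> 0"
    unfolding e_def by (rule LIMSEQ_Suc[OF lim_1_over_n])
  have [measurable]: "f \<in> borel_measurable borel"
    using f by auto
  let ?T = "\<lambda>w. l2 (\<lambda>x. f (x - w) - f x)"
  let ?H = "autocorrelation f"
  have H_meas[measurable]: "?H \<in> borel_measurable borel"
    using integrable_autocorrelation[OF f] by auto
  have T_eq: "?T = (\<lambda>w. 2 * (l2 f - Re (?H w)))"
    using Re_autocorrelation[OF sq] by (auto simp: field_simps)
  have "(\<lambda>n. LINT w|lborel. Re (?H (e n *\<^sub>R w)) * gauss_hat w) \<longlonglongrightarrow> (LINT w::'a|lborel. l2 f * gauss_hat w)"
  proof (rule Bochner_Integration.integral_dominated_convergence[where w = "\<lambda>w. l2 f * gauss_hat w"])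
    show "AE w in lborel. (\<lambda>n. Re (?H (e n *\<^sub>R w)) * gauss_hat w) \<longlonglongrightarrow> l2 f * gauss_hat w"
    proof (rule AE_I2)
      fix w :: 'a
      have "(\<lambda>n. e n *\<^sub>R w) \<longlonglongrightarrow> 0 *\<^sub>R w"
        by (intro tendsto_intros e_lim)
      then have "(\<lambda>n. ?T (e n *\<^sub>R w)) \<longlonglongrightarrow> 0"
        using translation_continuous_square_integrable[OF sq] by (simp add: translation_continuous_def)
      then have "(\<lambda>n. (l2 f - ?T (e n *\<^sub>R w) / 2) * gauss_hat w) \<longlonglongrightarrow> (l2 f - 0 / 2) * gauss_hat w"
        by (intro tendsto_intros) auto
      then show "(\<lambda>n. Re (?H (e n *\<^sub>R w)) * gauss_hat w) \<longlonglongrightarrow> l2 f * gauss_hat w"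
        by (simp add: Re_autocorrelation[OF sq])
    qed
    have "\<bar>Re (?H w)\<bar> \<le> l2 f" for w
    proof -
      have "?T w \<le> 2 * (l2 f + l2 f)"
        using l2_diff_le[OF square_integrable_translate(1)[OF sq, of w] sq] square_integrable_translate(2)[OF sq, of w]
        by simp
      then show ?thesis
        using l2_nonneg[of "\<lambda>x. f (x - w) - f x"] unfolding Re_autocorrelation[OF sq] by (simp add: abs_le_iff)
    qed
    then show "AE w in lborel. norm (Re (?H (e n *\<^sub>R w)) * gauss_hat w) \<le> l2 f * gauss_hat w" for n
      by (auto simp: abs_mult intro!: mult_right_mono)
  qed auto
  then have lim: "(\<lambda>n. LINT \<xi>|lborel. (norm (fourier_integral f \<xi>))\<^sup>2 * gauss (e n *\<^sub>R \<xi>)) \<longlonglongrightarrow> l2 f"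
    by (simp add: integral_fourier_gauss[OF f sq e0] integral_gauss_hat)
  \<comment> \<open>Monotone convergence is the right limit theorem here, because square
    integrability of the transform is itself part of the claim. The weights increase as
    \<open>e n\<close> decreases.\<close>
  have mono: "AE \<xi> in lborel. mono (\<lambda>n. (norm (fourier_integral f \<xi>))\<^sup>2 * gauss (e n *\<^sub>R \<xi>))"
  proof (intro AE_I2 monoI mult_left_mono)
    fix \<xi> :: 'a and m n :: nat assume "m \<le> n"
    have "(norm (e n *\<^sub>R \<xi>))\<^sup>2 \<le> (norm (e m *\<^sub>R \<xi>))\<^sup>2"
      using e_dec[OF \<open>m \<le> n\<close>] e0[of n] by (intro power_mono) (auto intro!: mult_right_mono)
    then show "gauss (e m *\<^sub>R \<xi>) \<le> gauss (e n *\<^sub>R \<xi>)"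
      by (simp add: gauss_def)
  qed auto
  have ptw: "AE \<xi> in lborel. (\<lambda>n. (norm (fourier_integral f \<xi>))\<^sup>2 * gauss (e n *\<^sub>R \<xi>))
      \<longlonglongrightarrow> (norm (fourier_integral f \<xi>))\<^sup>2"
  proof (rule AE_I2)
    fix \<xi> :: 'a
    have "(\<lambda>n. (norm (fourier_integral f \<xi>))\<^sup>2 * gauss (e n *\<^sub>R \<xi>))
        \<longlonglongrightarrow> (norm (fourier_integral f \<xi>))\<^sup>2 * exp (- (norm (0 *\<^sub>R \<xi>))\<^sup>2 / 2)"
      unfolding gauss_def by (intro tendsto_intros e_lim) auto
    then show "(\<lambda>n. (norm (fourier_integral f \<xi>))\<^sup>2 * gauss (e n *\<^sub>R \<xi>))
        \<longlonglongrightarrow> (norm (fourier_integral f \<xi>))\<^sup>2" by simp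
  qed
  \<comment> \<open>For fixed \<open>n\<close> the transform is bounded by the \<open>L^1\<close>
    norm of \<open>f\<close>, and the Gaussian supplies the decay.\<close>
  have int: "integrable lborel (\<lambda>\<xi>. (norm (fourier_integral f \<xi>))\<^sup>2 * gauss (e n *\<^sub>R \<xi>))" for n
  proof (rule Bochner_Integration.integrable_bound)
    show "integrable lborel (\<lambda>\<xi>::'a. (LINT x|lborel. norm (f x))\<^sup>2 * gauss (e n *\<^sub>R \<xi>))"
      using integrable_lborel_affine[OF integrable_gauss, of "e n" 0] e0[of n] by (intro integrable_mult_right) simp
  qed (auto simp: abs_mult intro!: mult_right_mono power_mono norm_fourier_integral_le[OF f])
  have "integrable lborel (\<lambda>\<xi>. (norm (fourier_integral f \<xi>))\<^sup>2)"
    by (rule integrable_monotone_convergence[OF int mono ptw lim]) simp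
  then show "square_integrable (fourier_integral f)"
    by (simp add: square_integrable_def)
  show "l2 (fourier_integral f) = l2 f"
    unfolding l2_def[of "fourier_integral f"]
    by (rule integral_monotone_convergence[OF int mono ptw lim]) simp
qed

subsection \<open>The Fourier transform of square integrable functions\<close>

lemma l2_eq_0_iff:
  "square_integrable f \<Longrightarrow> l2 f = 0 \<longleftrightarrow> (AE x in lborel. f x = 0)"
  by (simp add: l2_def integral_nonneg_eq_0_iff_AE square_integrable_integrable)

text \<open>Fatou's lemma. The bounds may vary with \<open>n\<close>, so that an error which
  disappears in the limit can be carried along.\<close>

lemma l2_le_AE_tendsto:
  fixes v :: "'a::euclidean_space \<Rightarrow> complex"
  assumes u: "\<And>n. square_integrable (u n)" and v[measurable]: "v \<in> borel_measurable borel"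
    and lim: "AE x in lborel. (\<lambda>n. u n x) \<longlonglongrightarrow> v x"
    and b: "\<And>n. l2 (u n) \<le> b n" "b \<longlonglongrightarrow> c"
  shows "square_integrable v" "l2 v \<le> c"
proof -
  have [measurable]: "u n \<in> borel_measurable borel" for n
    using u by (auto dest: square_integrable_measurable)
  have c: "c \<ge> 0"
    by (rule LIMSEQ_le_const[OF b(2)]) (use b(1) l2_nonneg order_trans in blast)
  have "(\<integral>\<^sup>+x. ennreal ((norm (v x))\<^sup>2) \<partial>lborel)
      = (\<integral>\<^sup>+x. liminf (\<lambda>n. ennreal ((norm (u n x))\<^sup>2)) \<partial>lborel)"
  proof (rule nn_integral_cong_AE)
    show "AE x in lborel. ennreal ((norm (v x))\<^sup>2) = liminf (\<lambda>n. ennreal ((norm (u n x))\<^sup>2))"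
      using lim
    proof eventually_elim
      case (elim x)
      then have "(\<lambda>n. ennreal ((norm (u n x))\<^sup>2)) \<longlonglongrightarrow> ennreal ((norm (v x))\<^sup>2)"
        by (intro tendsto_intros) auto
      then show ?case
        by (intro lim_imp_Liminf[symmetric]) auto
    qed
  qed
  also have "\<dots> \<le> liminf (\<lambda>n. \<integral>\<^sup>+x. ennreal ((norm (u n x))\<^sup>2) \<partial>lborel)"
    by (rule nn_integral_liminf) measurable
  also have "\<dots> = liminf (\<lambda>n. ennreal (l2 (u n)))"
    using u by (simp add: nn_integral_eq_l2)
  also have "\<dots> \<le> liminf (\<lambda>n. ennreal (b n))"
    by (intro Liminf_mono always_eventually allI ennreal_leI b)
  also have "\<dots> = ennreal c"
    by (intro lim_imp_Liminf tendsto_ennrealI b) auto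
  finally have le: "(\<integral>\<^sup>+x. ennreal ((norm (v x))\<^sup>2) \<partial>lborel) \<le> ennreal c" .
  then show v: "square_integrable v"
    by (auto simp: square_integrable_iff_nn_integral intro: le_less_trans)
  from le show "l2 v \<le> c"
    unfolding nn_integral_eq_l2[OF v] using c by simp
qed

lemma ball_truncation_square_integrable:
  assumes f: "square_integrable (f :: 'a::euclidean_space \<Rightarrow> complex)"
  shows "square_integrable (ball_truncation R f)"
proof -
  have [measurable]: "f \<in> borel_measurable borel"
    using f by (auto dest: square_integrable_measurable)
  have "ball_truncation R f \<in> borel_measurable borel"
    unfolding ball_truncation_def by measurable
  then show ?thesis
    by (rule square_integrable_mono[OF f]) (auto simp: ball_truncation_def)
qed

lemma ball_truncation_integrable:
  assumes f: "square_integrable (f :: 'a::euclidean_space \<Rightarrow> complex)"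
  shows "integrable lborel (ball_truncation R f)"
  by (rule square_integrable_bounded_support_integrable[OF ball_truncation_square_integrable[OF f], of R])
     (auto simp: ball_truncation_def)

lemma tendsto_l2_ball_truncation:
  assumes f: "square_integrable (f :: 'a::euclidean_space \<Rightarrow> complex)"
  shows "((\<lambda>R. l2 (\<lambda>x. f x - ball_truncation R f x)) \<longlongrightarrow> 0) at_top"
proof -
  have [measurable]: "f \<in> borel_measurable borel" "ball_truncation R f \<in> borel_measurable borel" for R
    using f ball_truncation_square_integrable[OF f] by (auto dest: square_integrable_measurable)
  have "((\<lambda>R. LINT x|lborel. (norm (f x - ball_truncation R f x))\<^sup>2)
      \<longlongrightarrow> (LINT x|(lborel::'a measure). (0::real))) at_top"
  proof (rule integral_dominated_convergence_at_top[where w = "\<lambda>x. (norm (f x))\<^sup>2"])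
    show "AE x in lborel. ((\<lambda>R. (norm (f x - ball_truncation R f x))\<^sup>2) \<longlongrightarrow> 0) at_top"
    proof (rule AE_I2, rule tendsto_eventually)
      fix x :: 'a
      show "\<forall>\<^sub>F R in at_top. (norm (f x - ball_truncation R f x))\<^sup>2 = 0"
        using eventually_ge_at_top[of "norm x"]
        by eventually_elim (simp add: ball_truncation_def)
    qed
    show "\<forall>\<^sub>F R in at_top. AE x in lborel. norm ((norm (f x - ball_truncation R f x))\<^sup>2) \<le> (norm (f x))\<^sup>2"
      by (intro always_eventually allI AE_I2) (auto simp: ball_truncation_def)
  qed (use f in \<open>auto intro: square_integrable_integrable\<close>)
  then show ?thesis by (simp add: l2_def)
qed

lemma square_integrable_fourier_ball_truncation:
  assumes f: "square_integrable (f :: 'a::euclidean_space \<Rightarrow> complex)"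
  shows "square_integrable (fourier_integral (ball_truncation R f))"
  by (intro square_integrable_fourier_integral ball_truncation_integrable ball_truncation_square_integrable f)

lemma l2_fourier_integral_diff:
  fixes f g :: "'a::euclidean_space \<Rightarrow> complex"
  assumes "integrable lborel f" "square_integrable f" "integrable lborel g" "square_integrable g"
  shows "l2 (\<lambda>\<xi>. fourier_integral f \<xi> - fourier_integral g \<xi>) = l2 (\<lambda>x. f x - g x)"
proof -
  have "(\<lambda>\<xi>. fourier_integral f \<xi> - fourier_integral g \<xi>) = fourier_integral (\<lambda>x. f x - g x)"
    using assms by (auto simp: fourier_integral_diff)
  then show ?thesis
    using assms by (simp add: l2_fourier_integral square_integrable_diff)
qed

text \<open>For square integrable \<open>g\<close> the distances are finite, so the
  \<open>ennreal\<close> limit of the definition can be replaced by a real one.\<close>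

lemma has_fourier_L2_iff_l2:
  fixes f :: "'a::euclidean_space \<Rightarrow> complex"
  assumes f: "square_integrable f"
  shows "has_fourier_L2 f g \<longleftrightarrow> square_integrable g \<and>
    ((\<lambda>R. l2 (\<lambda>\<xi>. fourier_integral (ball_truncation R f) \<xi> - g \<xi>)) \<longlongrightarrow> 0) at_top"
proof (cases "square_integrable g")
  case True
  have "(\<integral>\<^sup>+ \<xi>. ennreal ((norm (fourier_integral (ball_truncation R f) \<xi> - g \<xi>))\<^sup>2) \<partial>lborel)
     = ennreal (l2 (\<lambda>\<xi>. fourier_integral (ball_truncation R f) \<xi> - g \<xi>))" for R
    by (rule nn_integral_eq_l2[OF square_integrable_diff[OF square_integrable_fourier_ball_truncation[OF f] True]])
  then show ?thesis
    unfolding has_fourier_L2_def using True by (simp flip: ennreal_0)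
qed (simp add: has_fourier_L2_def)

text \<open>By Plancherel the transforms of the truncations form a Cauchy family. The limit is built
  as in the Riesz-Fischer theorem, from a rapidly converging subsequence that converges almost
  everywhere.\<close>

theorem has_fourier_L2_exists:
  fixes f :: "'a::euclidean_space \<Rightarrow> complex"
  assumes f: "square_integrable f"
  shows "\<exists>g. has_fourier_L2 f g"
proof -
  define t where "t R = ball_truncation R f" for R
  define F where "F R = fourier_integral (t R)" for R
  define \<delta> where "\<delta> R = l2 (\<lambda>x. f x - t R x)" for R
  have \<delta>: "(\<delta> \<longlongrightarrow> 0) at_top"
    unfolding \<delta>_def t_def by (rule tendsto_l2_ball_truncation[OF f])
  have t: "square_integrable (t R)" "integrable lborel (t R)" for R
    unfolding t_def using f by (auto intro: ball_truncation_square_integrable ball_truncation_integrable)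
  have F: "square_integrable (F R)" for R
    unfolding F_def t_def by (rule square_integrable_fourier_ball_truncation[OF f])
  have [measurable]: "F R \<in> borel_measurable borel" for R
    using F by (auto dest: square_integrable_measurable)
  have dist: "l2 (\<lambda>\<xi>. F R \<xi> - F R' \<xi>) \<le> 2 * (\<delta> R + \<delta> R')" for R R'
  proof -
    have "l2 (\<lambda>\<xi>. F R \<xi> - F R' \<xi>) = l2 (\<lambda>x. t R x - t R' x)"
      unfolding F_def by (intro l2_fourier_integral_diff t)
    also have "\<dots> = l2 (\<lambda>x. (f x - t R' x) - (f x - t R x))"
      by simp
    also have "\<dots> \<le> 2 * (\<delta> R' + \<delta> R)"
      unfolding \<delta>_def by (intro l2_diff_le square_integrable_diff f t)
    finally show ?thesis by simp
  qed
  \<comment> \<open>The rate 1/8 leaves room for the weight 4^k: the weighted squares below still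
    sum like 2^-k. Nothing forces these radii to tend to infinity; only the decay of \<delta> along
    them is used.\<close>
  have "\<exists>R. \<delta> R < (1/8) ^ k" for k
    using order_tendstoD(2)[OF \<delta>, of "(1/8) ^ k"] by (auto dest: eventually_happens)
  then obtain R where R: "\<And>k. \<delta> (R k) < (1/8) ^ k"
    by metis
  define G where "G k \<xi> = F (R (Suc k)) \<xi> - F (R k) \<xi>" for k \<xi>
  have G: "square_integrable (G k)" for k
    unfolding G_def by (intro square_integrable_diff F)
  have [measurable]: "G k \<in> borel_measurable borel" for k
    using G by (auto dest: square_integrable_measurable)
  have lG: "l2 (G k) \<le> 4 * (1/8) ^ k" for k
  proof -
    have "l2 (G k) \<le> 2 * (\<delta> (R (Suc k)) + \<delta> (R k))"
      unfolding G_def by (rule dist)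
    also have "\<dots> \<le> 2 * ((1/8) ^ k + (1/8) ^ k)"
      using order_trans[OF less_imp_le[OF R[of "Suc k"]] power_decreasing[of k "Suc k" "1/8::real"]] R[of k]
      by (intro mult_left_mono add_mono) auto
    finally show ?thesis by simp
  qed
  have "(\<integral>\<^sup>+\<xi>. (\<Sum>k. ennreal (4 ^ k * (norm (G k \<xi>))\<^sup>2)) \<partial>lborel)
      = (\<Sum>k. \<integral>\<^sup>+\<xi>. ennreal (4 ^ k * (norm (G k \<xi>))\<^sup>2) \<partial>lborel)"
    by (rule nn_integral_suminf) measurable
  also have "\<dots> = (\<Sum>k. ennreal (4 ^ k * l2 (G k)))"
    using G by (simp add: ennreal_mult nn_integral_cmult nn_integral_eq_l2)
  also have "\<dots> \<le> (\<Sum>k. ennreal (4 * (1/2) ^ k))"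
  proof (intro suminf_le ennreal_leI)
    fix k
    have "4 ^ k * l2 (G k) \<le> 4 ^ k * (4 * (1/8) ^ k)"
      by (intro mult_left_mono lG) auto
    also have "(4::real) ^ k * (4 * (1/8) ^ k) = 4 * (4 ^ k * (1/8) ^ k)"
      by simp
    also have "(4::real) ^ k * (1/8) ^ k = (1/2) ^ k"
      by (subst power_mult_distrib[symmetric]) simp
    finally show "4 ^ k * l2 (G k) \<le> 4 * (1/2) ^ k" .
  qed auto
  also have "\<dots> < \<infinity>"
    by (subst suminf_ennreal2) (auto intro!: summable_mult summable_geometric)
  finally have "AE \<xi> in lborel. (\<Sum>k. ennreal (4 ^ k * (norm (G k \<xi>))\<^sup>2)) \<noteq> \<infinity>"
    by (intro nn_integral_noteq_infinite) auto
  then have conv: "AE \<xi> in lborel. convergent (\<lambda>k. F (R k) \<xi>)"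
  proof eventually_elim
    case (elim \<xi>)
    then have "summable (\<lambda>k. 4 ^ k * (norm (G k \<xi>))\<^sup>2)"
      by (intro summable_suminf_not_top) auto
    then have "summable (\<lambda>k. 4 ^ k * (norm (G k \<xi>))\<^sup>2 + (1/4) ^ k)"
      by (intro summable_add summable_geometric) auto
    then have "summable (\<lambda>k. G k \<xi>)"
    proof (rule summable_comparison_test')
      fix k :: nat
      \<comment> \<open>The weight 4^k pays for the passage from summable squares to summable
        norms.\<close>
      have "2 * (2 ^ k * norm (G k \<xi>)) * (1/2) ^ k \<le> (2 ^ k * norm (G k \<xi>))\<^sup>2 + ((1/2) ^ k)\<^sup>2"
        by (rule sum_squares_bound)
      moreover have "(2 ^ k * norm (G k \<xi>)) * (1/2) ^ k = norm (G k \<xi>)"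
        by (simp add: power_divide)
      moreover have four: "(4::real) ^ k = 2 ^ k * 2 ^ k"
        by (subst power_mult_distrib[symmetric]) simp
      moreover have "(2 ^ k * norm (G k \<xi>))\<^sup>2 = 4 ^ k * (norm (G k \<xi>))\<^sup>2"
        by (simp add: four power2_eq_square)
      moreover have "((1/2::real) ^ k)\<^sup>2 = (1/4) ^ k"
        by (simp add: four power2_eq_square power_divide)
      ultimately show "norm (G k \<xi>) \<le> 4 ^ k * (norm (G k \<xi>))\<^sup>2 + (1/4) ^ k"
        using norm_ge_zero[of "G k \<xi>"] by linarith
    qed
    then have "(\<lambda>n. F (R 0) \<xi> + (\<Sum>k<n. G k \<xi>)) \<longlonglongrightarrow> F (R 0) \<xi> + (\<Sum>k. G k \<xi>)"
      by (intro tendsto_intros summable_LIMSEQ)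
    then show ?case
      by (auto simp: G_def sum_lessThan_telescope[of "\<lambda>k. F (R k) \<xi>"] convergent_def)
  qed
  \<comment> \<open>On the null set where the sequence diverges \<open>lim\<close> is some
    unspecified value; measurability holds regardless.\<close>
  define g where "g \<xi> = lim (\<lambda>k. F (R k) \<xi>)" for \<xi>
  have [measurable]: "g \<in> borel_measurable borel"
    unfolding g_def by measurable
  have Rlim: "(\<lambda>k. \<delta> (R k)) \<longlonglongrightarrow> 0"
  proof (rule tendsto_sandwich[OF _ _ tendsto_const])
    show "\<forall>\<^sub>F k in sequentially. \<delta> (R k) \<le> (1/8) ^ k"
      using R by (simp add: less_imp_le)
    show "(\<lambda>k. (1/8::real) ^ k) \<longlonglongrightarrow> 0"
      by (rule LIMSEQ_power_zero) simp
  qed (simp add: \<delta>_def)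
  \<comment> \<open>Fatou is applied with an arbitrary radius \<open>r\<close> against the
    subsequence, which gives convergence along all radii. The \<open>0\<close> is the limit of the
    error of the subsequence.\<close>
  have le: "square_integrable (\<lambda>\<xi>. F r \<xi> - g \<xi>)" "l2 (\<lambda>\<xi>. F r \<xi> - g \<xi>) \<le> 2 * (\<delta> r + 0)" for r
  proof -
    have 1: "square_integrable (\<lambda>\<xi>. F r \<xi> - F (R k) \<xi>)" for k
      by (intro square_integrable_diff F)
    have 2: "AE \<xi> in lborel. (\<lambda>k. F r \<xi> - F (R k) \<xi>) \<longlonglongrightarrow> F r \<xi> - g \<xi>"
      using conv by eventually_elim (auto simp: g_def convergent_LIMSEQ_iff intro!: tendsto_intros)
    have 3: "(\<lambda>k. 2 * (\<delta> r + \<delta> (R k))) \<longlonglongrightarrow> 2 * (\<delta> r + 0)"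
      by (intro tendsto_intros Rlim)
    have 4: "(\<lambda>\<xi>. F r \<xi> - g \<xi>) \<in> borel_measurable borel"
      by measurable
    show "square_integrable (\<lambda>\<xi>. F r \<xi> - g \<xi>)" "l2 (\<lambda>\<xi>. F r \<xi> - g \<xi>) \<le> 2 * (\<delta> r + 0)"
      using l2_le_AE_tendsto[OF 1 4 2 dist 3] by auto
  qed
  have "square_integrable g"
    using square_integrable_diff[OF F[of 0] le(1)[of 0]] by simp
  moreover have "((\<lambda>r. l2 (\<lambda>\<xi>. F r \<xi> - g \<xi>)) \<longlongrightarrow> 0) at_top"
  proof (rule tendsto_sandwich[OF _ _ tendsto_const])
    show "\<forall>\<^sub>F r in at_top. l2 (\<lambda>\<xi>. F r \<xi> - g \<xi>) \<le> 2 * (\<delta> r + 0)"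
      using le(2) by (intro always_eventually) blast
    show "((\<lambda>r. 2 * (\<delta> r + 0)) \<longlongrightarrow> 0) at_top"
      by (rule tendsto_eq_rhs[OF tendsto_mult_left[OF tendsto_add[OF \<delta> tendsto_const]]]) simp
  qed auto
  ultimately show ?thesis
    unfolding has_fourier_L2_iff_l2[OF f] F_def t_def by blast
qed

section \<open>Plancherel, uniqueness and the multiplication formula for square integrable
  functions\<close>

lemma has_fourier_L2_square_integrable: "has_fourier_L2 f g \<Longrightarrow> square_integrable g"
  by (simp add: has_fourier_L2_def)

lemma has_fourier_L2_fourier_integral:
  fixes f :: "'a::euclidean_space \<Rightarrow> complex"
  assumes f: "integrable lborel f" and sq: "square_integrable f"
  shows "has_fourier_L2 f (fourier_integral f)"
  unfolding has_fourier_L2_iff_l2[OF sq]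
proof
  have "l2 (\<lambda>\<xi>. fourier_integral (ball_truncation R f) \<xi> - fourier_integral f \<xi>)
      = l2 (\<lambda>x. f x - ball_truncation R f x)" for R
    by (subst l2_fourier_integral_diff)
       (auto simp: f sq ball_truncation_integrable ball_truncation_square_integrable intro: l2_uminus_diff)
  then show "((\<lambda>R. l2 (\<lambda>\<xi>. fourier_integral (ball_truncation R f) \<xi> - fourier_integral f \<xi>)) \<longlongrightarrow> 0) at_top"
    using tendsto_l2_ball_truncation[OF sq] by simp
qed (rule square_integrable_fourier_integral[OF f sq])

theorem Plancherel:
  fixes f :: "'a::euclidean_space \<Rightarrow> complex"
  assumes f: "square_integrable f" and g: "has_fourier_L2 f g"
  shows "l2 g = l2 f"
proof -
  have "((\<lambda>R. l2 (fourier_integral (ball_truncation R f))) \<longlongrightarrow> l2 g) at_top"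
    using g unfolding has_fourier_L2_iff_l2[OF f]
    by (intro tendsto_l2 square_integrable_fourier_ball_truncation f) auto
  moreover have "((\<lambda>R. l2 (ball_truncation R f)) \<longlongrightarrow> l2 f) at_top"
    using tendsto_l2_ball_truncation[OF f]
    by (intro tendsto_l2 ball_truncation_square_integrable f) (simp add: l2_uminus_diff)
  moreover have "l2 (fourier_integral (ball_truncation R f)) = l2 (ball_truncation R f)" for R
    by (intro l2_fourier_integral ball_truncation_integrable ball_truncation_square_integrable f)
  ultimately show ?thesis
    using tendsto_unique[OF trivial_limit_at_top_linorder] by simp
qed

text \<open>Two limits of the same family have distance zero. Hence the choice made in
  \<open>fourier_L2\<close> does not matter up to null sets, and any explicit transform may replace
  it under an integral.\<close>

lemma has_fourier_L2_unique:
  fixes f :: "'a::euclidean_space \<Rightarrow> complex"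
  assumes f: "square_integrable f" and g: "has_fourier_L2 f g" and h: "has_fourier_L2 f h"
  shows "AE \<xi> in lborel. g \<xi> = h \<xi>"
proof -
  let ?F = "\<lambda>R. fourier_integral (ball_truncation R f)"
  have F: "square_integrable (?F R)" for R
    by (rule square_integrable_fourier_ball_truncation[OF f])
  have gh: "square_integrable g" "square_integrable h"
    using g h by (auto dest: has_fourier_L2_square_integrable)
  have "((\<lambda>R. 2 * (l2 (\<lambda>\<xi>. ?F R \<xi> - h \<xi>) + l2 (\<lambda>\<xi>. ?F R \<xi> - g \<xi>))) \<longlongrightarrow> 2 * (0 + 0)) at_top"
    using g h unfolding has_fourier_L2_iff_l2[OF f] by (intro tendsto_intros) auto
  moreover have "l2 (\<lambda>\<xi>. g \<xi> - h \<xi>) \<le> 2 * (l2 (\<lambda>\<xi>. ?F R \<xi> - h \<xi>) + l2 (\<lambda>\<xi>. ?F R \<xi> - g \<xi>))" for R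
    using l2_diff_le[OF square_integrable_diff[OF F gh(2)] square_integrable_diff[OF F gh(1)], of R R] by simp
  ultimately have "l2 (\<lambda>\<xi>. g \<xi> - h \<xi>) \<le> 2 * (0 + 0)"
    by (intro tendsto_lowerbound) auto
  then have "l2 (\<lambda>\<xi>. g \<xi> - h \<xi>) = 0"
    by (intro antisym) auto
  then show ?thesis
    using l2_eq_0_iff[OF square_integrable_diff[OF gh]] by simp
qed

text \<open>Both pairings are continuous in \<open>L^2\<close>, so the formula passes to the limit
  in the truncation radius. It does the work of an inversion theorem in the frequency
  splitting.\<close>

lemma has_fourier_L2_multiplication_formula:
  fixes f k :: "'a::euclidean_space \<Rightarrow> complex"
  assumes f: "square_integrable f" and g: "has_fourier_L2 f g"
    and k: "integrable lborel k" "square_integrable k"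
  shows "(LINT x|lborel. f x * fourier_integral k x) = (LINT \<xi>|lborel. g \<xi> * k \<xi>)"
proof -
  have "((\<lambda>R. LINT \<xi>|lborel. fourier_integral (ball_truncation R f) \<xi> * k \<xi>)
      \<longlongrightarrow> (LINT \<xi>|lborel. g \<xi> * k \<xi>)) at_top"
    using g unfolding has_fourier_L2_iff_l2[OF f]
    by (intro tendsto_integral_mult_l2 square_integrable_fourier_ball_truncation f k) auto
  moreover have "((\<lambda>R. LINT x|lborel. ball_truncation R f x * fourier_integral k x)
      \<longlongrightarrow> (LINT x|lborel. f x * fourier_integral k x)) at_top"
    using tendsto_l2_ball_truncation[OF f]
    by (intro tendsto_integral_mult_l2 ball_truncation_square_integrable square_integrable_fourier_integral f k)
       (simp add: l2_uminus_diff)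
  ultimately show ?thesis
    using tendsto_unique[OF trivial_limit_at_top_linorder]
    by (simp add: fourier_multiplication_formula[OF ball_truncation_integrable[OF f] k(1)])
qed

text \<open>\<open>v\<close> is the inverse transform of the truncation \<open>b\<close> of
  \<open>g\<close>, written as the conjugate of the transform of \<open>cnj b\<close>; its sup norm
  is at most the \<open>L^1\<close> norm of \<open>b\<close>. The multiplication formula identifies
  the pairing of \<open>f\<close> with \<open>v\<close> and that of \<open>g\<close> with
  \<open>b\<close>, and Plancherel identifies the norms, so both expanded distances agree.\<close>

lemma low_frequency_part:
  fixes f :: "'a::euclidean_space \<Rightarrow> complex"
  assumes f: "square_integrable f" and g: "has_fourier_L2 f g"
  obtains v where "square_integrable v"
    "\<And>x. norm (v x) \<le> (LINT \<xi>|lborel. norm (ball_truncation A g \<xi>))"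
    "l2 (\<lambda>x. f x - v x) = l2 (\<lambda>\<xi>. g \<xi> - ball_truncation A g \<xi>)"
proof -
  have gs: "square_integrable g"
    using g by (rule has_fourier_L2_square_integrable)
  define b where "b = ball_truncation A g"
  have b: "square_integrable b" "integrable lborel b"
    unfolding b_def by (intro ball_truncation_square_integrable ball_truncation_integrable gs)+
  define k where "k = (\<lambda>\<xi>. cnj (b \<xi>))"
  have k: "square_integrable k" "integrable lborel k"
    unfolding k_def using b by (auto intro: square_integrable_cnj)
  define v where "v = (\<lambda>x. cnj (fourier_integral k x))"
  have v: "square_integrable v"
    unfolding v_def by (intro square_integrable_cnj square_integrable_fourier_integral k)
  have "l2 v = l2 (fourier_integral k)"
    by (simp add: l2_def v_def)
  also have "\<dots> = l2 b"
    using l2_fourier_integral[OF k(2,1)] by (simp add: l2_def k_def)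
  finally have lv: "l2 v = l2 b" .
  have "l2 (\<lambda>x. f x - v x) = l2 f + l2 v - 2 * Re (LINT x|lborel. f x * cnj (v x))"
    by (rule l2_diff_expand[OF f v])
  also have "\<dots> = l2 g + l2 b - 2 * Re (LINT \<xi>|lborel. g \<xi> * cnj (b \<xi>))"
    using has_fourier_L2_multiplication_formula[OF f g k(2,1)] lv Plancherel[OF f g]
    by (simp add: v_def k_def)
  also have "\<dots> = l2 (\<lambda>\<xi>. g \<xi> - b \<xi>)"
    by (rule l2_diff_expand[OF gs b(1), symmetric])
  finally have "l2 (\<lambda>x. f x - v x) = l2 (\<lambda>\<xi>. g \<xi> - ball_truncation A g \<xi>)"
    by (simp add: b_def)
  moreover have "norm (v x) \<le> (LINT \<xi>|lborel. norm (ball_truncation A g \<xi>))" for x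
    using norm_fourier_integral_le[OF k(2), of x] by (simp add: v_def k_def b_def)
  ultimately show thesis
    using that v by blast
qed

lemma
  fixes f :: "'a::euclidean_space \<Rightarrow> 'b::real_normed_vector"
  assumes f: "square_integrable f" and c: "c > 0"
  shows square_integrable_scale: "square_integrable (\<lambda>x. f (c *\<^sub>R x))"
    and l2_scale: "l2 (\<lambda>x. f (c *\<^sub>R x)) = l2 f / c ^ DIM('a)"
proof -
  have [measurable]: "f \<in> borel_measurable borel"
    using f by (auto dest: square_integrable_measurable)
  show "square_integrable (\<lambda>x. f (c *\<^sub>R x))"
    using integrable_lborel_affine[OF square_integrable_integrable[OF f], of c 0] c
    by (simp add: square_integrable_def)
  have "l2 f = \<bar>c\<bar> ^ DIM('a) *\<^sub>R l2 (\<lambda>x. f (c *\<^sub>R x))"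
    unfolding l2_def using c by (subst integral_lborel_affine[of _ c 0]) auto
  then show "l2 (\<lambda>x. f (c *\<^sub>R x)) = l2 f / c ^ DIM('a)"
    using c by simp
qed

text \<open>Truncating the dilated function at radius \<open>R\<close> means truncating
  \<open>f\<close> at radius \<open>c * R\<close>, which also tends to infinity; the squared
  distances differ by the fixed factor \<open>c ^ DIM('a)\<close>.\<close>

lemma has_fourier_L2_scale:
  fixes f :: "'a::euclidean_space \<Rightarrow> complex"
  assumes f: "square_integrable f" and g: "has_fourier_L2 f g" and c: "c > 0"
  shows "has_fourier_L2 (\<lambda>x. f (c *\<^sub>R x)) (\<lambda>\<xi>. g (\<xi> /\<^sub>R c) / of_real (c ^ DIM('a)))"
  unfolding has_fourier_L2_iff_l2[OF square_integrable_scale[OF f c]]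
proof
  have gs: "square_integrable g"
    using g by (rule has_fourier_L2_square_integrable)
  have c': "inverse c > 0" using c by simp
  have [measurable]: "f \<in> borel_measurable borel" "g \<in> borel_measurable borel"
    using f gs by (auto dest: square_integrable_measurable)
  have "integrable lborel (\<lambda>\<xi>. (norm (g (\<xi> /\<^sub>R c)))\<^sup>2 / (c ^ DIM('a))\<^sup>2)"
    using square_integrable_integrable[OF square_integrable_scale[OF gs c']] by simp
  then show "square_integrable (\<lambda>\<xi>. g (\<xi> /\<^sub>R c) / of_real (c ^ DIM('a)))"
    using c by (simp add: square_integrable_def norm_divide norm_power power_divide)
  have eq: "l2 (\<lambda>\<xi>. fourier_integral (ball_truncation R (\<lambda>x. f (c *\<^sub>R x))) \<xi> - g (\<xi> /\<^sub>R c) / of_real (c ^ DIM('a)))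
      = l2 (\<lambda>\<xi>. fourier_integral (ball_truncation (c * R) f) \<xi> - g \<xi>) / c ^ DIM('a)" for R
  proof -
    let ?d = "\<lambda>\<xi>. fourier_integral (ball_truncation (c * R) f) \<xi> - g \<xi>"
    have d: "square_integrable ?d"
      by (intro square_integrable_diff square_integrable_fourier_ball_truncation f gs)
    have bt: "ball_truncation R (\<lambda>x. f (c *\<^sub>R x)) = (\<lambda>x. ball_truncation (c * R) f (c *\<^sub>R x))"
      using c by (auto simp: ball_truncation_def fun_eq_iff)
    have "ball_truncation (c * R) f \<in> borel_measurable borel"
      using ball_truncation_square_integrable[OF f] by (auto dest: square_integrable_measurable)
    then have "(\<lambda>\<xi>. fourier_integral (ball_truncation R (\<lambda>x. f (c *\<^sub>R x))) \<xi> - g (\<xi> /\<^sub>R c) / of_real (c ^ DIM('a)))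
       = (\<lambda>\<xi>. ?d (inverse c *\<^sub>R \<xi>) / of_real (c ^ DIM('a)))"
      unfolding bt by (simp add: fourier_integral_scale c diff_divide_distrib)
    then have "l2 (\<lambda>\<xi>. fourier_integral (ball_truncation R (\<lambda>x. f (c *\<^sub>R x))) \<xi> - g (\<xi> /\<^sub>R c) / of_real (c ^ DIM('a)))
       = l2 (\<lambda>\<xi>. ?d (inverse c *\<^sub>R \<xi>)) / (c ^ DIM('a))\<^sup>2"
      using c by (simp add: l2_def norm_divide norm_power power_divide)
    also have "\<dots> = l2 ?d / c ^ DIM('a)"
      unfolding l2_scale[OF d c'] using c by (simp add: power2_eq_square field_simps)
    finally show ?thesis .
  qed
  have "((\<lambda>R. l2 (\<lambda>\<xi>. fourier_integral (ball_truncation R f) \<xi> - g \<xi>)) \<longlongrightarrow> 0) at_top"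
    using g unfolding has_fourier_L2_iff_l2[OF f] by simp
  moreover have "filterlim (\<lambda>R. c * R) at_top at_top"
    by (rule filterlim_tendsto_pos_mult_at_top[OF tendsto_const c filterlim_ident])
  ultimately have "((\<lambda>R. l2 (\<lambda>\<xi>. fourier_integral (ball_truncation (c * R) f) \<xi> - g \<xi>)) \<longlongrightarrow> 0) at_top"
    by (rule filterlim_compose)
  then show "((\<lambda>R. l2 (\<lambda>\<xi>. fourier_integral (ball_truncation R (\<lambda>x. f (c *\<^sub>R x))) \<xi> - g (\<xi> /\<^sub>R c) / of_real (c ^ DIM('a)))) \<longlongrightarrow> 0) at_top"
    unfolding eq by (rule tendsto_eq_rhs[OF tendsto_divide[OF _ tendsto_const]]) (use c in auto)
qed

lemma has_fourier_L2_fourier_L2: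
  assumes "square_integrable u"
  shows "has_fourier_L2 (\<lambda>x. complex_of_real (u x)) (fourier_L2 u)"
proof -
  have [measurable]: "u \<in> borel_measurable borel"
    using assms by (auto dest: square_integrable_measurable)
  have "square_integrable (\<lambda>x. complex_of_real (u x))"
    by (rule square_integrable_mono[OF assms]) auto
  then show ?thesis
    unfolding fourier_L2_def by (rule someI_ex[OF has_fourier_L2_exists])
qed

subsection \<open>The fractional Sobolev inequality\<close>

lemma dyadic_bracket:
  assumes "0 < x" "x \<le> (1::real)"
  shows "\<exists>k. (1/2) ^ Suc k < x \<and> x \<le> (1/2) ^ k"
proof -
  define P where "P n \<longleftrightarrow> (1/2) ^ Suc n < x" for n :: nat
  define k where "k = (LEAST n. P n)"
  obtain n :: nat where "(1/2) ^ n < x"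
    using real_arch_pow_inv[of x "1/2"] assms by auto
  then have "P n"
    unfolding P_def by (rule le_less_trans[rotated]) (simp add: power_decreasing)
  then have "P k"
    unfolding k_def by (rule LeastI)
  moreover have "x \<le> (1/2) ^ k"
  proof (cases k)
    case (Suc j)
    then have "\<not> P j"
      unfolding k_def by (intro not_less_Least) simp
    then show ?thesis
      by (simp add: P_def Suc)
  qed (use assms in simp)
  ultimately show ?thesis
    by (auto simp: P_def)
qed

text \<open>On the shell 2^(-k-1) < |\<xi>| \<le> 2^-k the integrand is at most q^(k+1), and the
  enclosing ball has measure \<omega> 2^(-kN). The series is geometric with ratio 2^(2s-N), below 1
  exactly when 2s < N.\<close>

lemma nn_integral_norm_powr_unit_ball:
  assumes s: "0 < s" "2 * s < real DIM('a::euclidean_space)"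
  shows "(\<integral>\<^sup>+\<xi>. ennreal (indicator (cball 0 1) \<xi> * norm (\<xi>::'a) powr (- 2 * s)) \<partial>lborel) < \<infinity>"
proof -
  define q :: real where "q = 2 powr (2 * s)"
  define \<omega> where "\<omega> = unit_ball_vol (real DIM('a))"
  have q: "q > 0" by (simp add: q_def)
  have \<omega>: "\<omega> \<ge> 0" by (simp add: \<omega>_def)
  have [measurable]: "cball (0::'a) r \<in> sets borel" for r
    by simp
  have le_suminf: "T k \<le> suminf T" for T :: "nat \<Rightarrow> ennreal" and k
    using sum_le_suminf[of T "{k}"] by simp
  have half_powr: "((1/2) ^ n) powr (- 2 * s) = q ^ n" for n
  proof (induction n)
    case (Suc n)
    have "(1/2::real) powr (- 2 * s) = q"
      by (simp add: q_def powr_divide powr_minus field_simps)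
    moreover have "((1/2::real) ^ Suc n) powr (- 2 * s) = (1/2) powr (- 2 * s) * ((1/2) ^ n) powr (- 2 * s)"
      by (simp only: power_Suc powr_mult)
    ultimately show ?case
      using Suc by (simp only: power_Suc)
  qed simp
  have "(\<integral>\<^sup>+\<xi>. ennreal (indicator (cball 0 1) \<xi> * norm (\<xi>::'a) powr (- 2 * s)) \<partial>lborel)
     \<le> (\<integral>\<^sup>+\<xi>. (\<Sum>k. ennreal (q ^ Suc k) * indicator (cball 0 ((1/2) ^ k)) (\<xi>::'a)) \<partial>lborel)"
  proof (rule nn_integral_mono)
    fix \<xi> :: 'a
    let ?t = "\<lambda>k. ennreal (q ^ Suc k) * indicator (cball 0 ((1/2) ^ k)) \<xi>"
    show "ennreal (indicator (cball 0 1) \<xi> * norm \<xi> powr (- 2 * s)) \<le> (\<Sum>k. ?t k)"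
    proof (cases "0 < norm \<xi> \<and> norm \<xi> \<le> 1")
      case True
      then obtain k where k: "(1/2) ^ Suc k < norm \<xi>" "norm \<xi> \<le> (1/2) ^ k"
        using dyadic_bracket by blast
      have "norm \<xi> powr (- 2 * s) \<le> ((1/2) ^ Suc k) powr (- 2 * s)"
        using k(1) s by (intro powr_mono2') auto
      also have "\<dots> = q ^ Suc k"
        by (rule half_powr)
      finally have "ennreal (indicator (cball 0 1) \<xi> * norm \<xi> powr (- 2 * s)) \<le> ?t k"
        using True k(2) by (auto simp: indicator_def intro!: ennreal_leI)
      also have "?t k \<le> (\<Sum>k. ?t k)"
        by (rule le_suminf)
      finally show ?thesis .
    next
      \<comment> \<open>This includes the origin, where \<open>0 powr (- 2 * s)\<close> is
        \<open>0\<close> by convention.\<close>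
      case False
      then show ?thesis by (auto simp: indicator_def)
    qed
  qed
  also have "\<dots> = (\<Sum>k. \<integral>\<^sup>+\<xi>. ennreal (q ^ Suc k) * indicator (cball 0 ((1/2) ^ k)) (\<xi>::'a) \<partial>lborel)"
    by (rule nn_integral_suminf) measurable
  also have "\<dots> = (\<Sum>k. ennreal (q ^ Suc k) * ennreal (\<omega> * ((1/2) ^ k) ^ DIM('a)))"
    by (simp add: nn_integral_cmult emeasure_cball \<omega>_def del: power_Suc)
  also have "\<dots> = (\<Sum>k. ennreal (q * \<omega> * (q * (1/2) ^ DIM('a)) ^ k))"
    using q \<omega> by (intro suminf_cong)
      (simp add: ennreal_mult[symmetric] power_mult_distrib power_mult[symmetric] mult_ac)
  also have "\<dots> < \<infinity>"
  proof -
    have "q < 2 powr real DIM('a)"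
      unfolding q_def using s by (intro powr_less_mono) auto
    then have "q * (1/2) ^ DIM('a) < 1"
      by (simp add: powr_realpow power_divide field_simps)
    then show ?thesis
      using q \<omega> by (subst suminf_ennreal2) (auto intro!: summable_mult summable_geometric)
  qed
  finally show ?thesis .
qed

text \<open>Homogeneity reduces every radius to the unit ball: two factors A^(-s) come from the
  weight and A^N from the volume.\<close>

lemma integral_norm_powr_ball:
  assumes s: "0 < s" "2 * s < real DIM('a::euclidean_space)"
  shows "\<exists>c>0. \<forall>A>0. square_integrable (\<lambda>\<xi>::'a. indicator (cball 0 A) \<xi> * norm \<xi> powr (- s)) \<and>
    l2 (\<lambda>\<xi>::'a. indicator (cball 0 A) \<xi> * norm \<xi> powr (- s)) \<le> c * A powr (real DIM('a) - 2 * s)"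
proof -
  define a where "a A \<xi> = indicator (cball 0 A) \<xi> * norm \<xi> powr (- s)" for A and \<xi> :: 'a
  have [measurable]: "a A \<in> borel_measurable borel" for A
  proof -
    have "(\<lambda>\<xi>. indicator (cball 0 A) \<xi> * norm \<xi> powr (- s)) \<in> borel_measurable (borel :: 'a measure)"
      by (intro borel_measurable_times borel_measurable_indicator powr_real_measurable borel_measurable_norm) auto
    then show ?thesis by (simp add: a_def[abs_def])
  qed
  have sq: "(norm (a A \<xi>))\<^sup>2 = indicator (cball 0 A) \<xi> * norm \<xi> powr (- 2 * s)" for A \<xi>
    by (auto simp: a_def indicator_def power2_eq_square simp flip: powr_add)
  have a1: "square_integrable (a 1)"
    unfolding square_integrable_iff_nn_integral sq using nn_integral_norm_powr_unit_ball[OF s] by simp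
  have aA: "a A (A *\<^sub>R \<xi>) = A powr (- s) * a 1 \<xi>" if "A > 0" for A \<xi>
    using that by (simp add: a_def indicator_def powr_mult)
  have aA': "a A \<xi> = A powr (- s) * a 1 (inverse A *\<^sub>R \<xi>)" if "A > 0" for A \<xi>
    using aA[OF that, of "inverse A *\<^sub>R \<xi>"] that by simp
  have sqA: "square_integrable (a A)" if A: "A > 0" for A
  proof -
    have "integrable lborel (\<lambda>\<xi>. (A powr (- s))\<^sup>2 * (norm (a 1 (inverse A *\<^sub>R \<xi>)))\<^sup>2)"
      using A by (intro integrable_mult_right square_integrable_integrable square_integrable_scale a1) auto
    then show ?thesis
      by (simp add: square_integrable_def aA'[OF A, abs_def] power_mult_distrib)
  qed
  have lA: "l2 (a A) = l2 (a 1) * A powr (real DIM('a) - 2 * s)" if A: "A > 0" for A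
  proof -
    have "l2 (a A) = (A powr (- s))\<^sup>2 * l2 (\<lambda>\<xi>. a 1 (inverse A *\<^sub>R \<xi>))"
      unfolding aA'[OF A, abs_def] by (simp add: l2_def power_mult_distrib)
    also have "\<dots> = (A powr (- s))\<^sup>2 * (l2 (a 1) * A ^ DIM('a))"
      using A by (simp add: l2_scale[OF a1] power_inverse field_simps)
    also have "(A powr (- s))\<^sup>2 * (l2 (a 1) * A ^ DIM('a)) = l2 (a 1) * (A powr (- s) * A powr (- s) * A powr real DIM('a))"
      using A by (simp add: power2_eq_square powr_realpow)
    also have "A powr (- s) * A powr (- s) * A powr real DIM('a) = A powr (real DIM('a) - 2 * s)"
      by (simp flip: powr_add)
    finally show ?thesis .
  qed
  \<comment> \<open>Adding 1 makes the constant strictly positive without a lower bound for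
    \<open>l2 (a 1)\<close>.\<close>
  have "l2 (a 1) + 1 > 0"
    by (simp add: add_nonneg_pos)
  moreover have "l2 (a A) \<le> (l2 (a 1) + 1) * A powr (real DIM('a) - 2 * s)" if "A > 0" for A
    using lA[OF that] by (simp add: algebra_simps)
  ultimately show ?thesis
    using sqA unfolding a_def[abs_def] by blast
qed

text \<open>Cauchy-Schwarz after writing the integrand as |\<xi>|^(-s), restricted to the ball,
  times |\<xi>|^s |g|. The constant is uniform in \<open>g\<close> and \<open>A\<close>, so the
  cut-off may later depend on both the level and the function.\<close>

lemma integral_norm_ball_truncation_le:
  fixes s :: real
  assumes s: "0 < s" "2 * s < real DIM('a::euclidean_space)"
  shows "\<exists>c>0. \<forall>(g :: 'a \<Rightarrow> complex) A. square_integrable g \<longrightarrow>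
      integrable lborel (\<lambda>\<xi>. norm \<xi> powr (2 * s) * (norm (g \<xi>))\<^sup>2) \<longrightarrow> A > 0 \<longrightarrow>
      (LINT \<xi>|lborel. norm (ball_truncation A g \<xi>)) \<le>
        sqrt (c * A powr (real DIM('a) - 2 * s) * (LINT \<xi>|lborel. norm \<xi> powr (2 * s) * (norm (g \<xi>))\<^sup>2))"
proof -
  obtain c where c: "c > 0"
    and a: "\<And>A. A > 0 \<Longrightarrow> square_integrable (\<lambda>\<xi>::'a. indicator (cball 0 A) \<xi> * norm \<xi> powr (- s))"
      "\<And>A. A > 0 \<Longrightarrow> l2 (\<lambda>\<xi>::'a. indicator (cball 0 A) \<xi> * norm \<xi> powr (- s)) \<le> c * A powr (real DIM('a) - 2 * s)"
    using integral_norm_powr_ball[OF s] by blast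
  show ?thesis
  proof (intro exI[of _ c] conjI c allI impI)
    fix g :: "'a \<Rightarrow> complex" and A :: real
    assume g: "square_integrable g" and A: "A > 0"
      and int: "integrable lborel (\<lambda>\<xi>. norm \<xi> powr (2 * s) * (norm (g \<xi>))\<^sup>2)"
    let ?K = "LINT \<xi>|lborel. norm \<xi> powr (2 * s) * (norm (g \<xi>))\<^sup>2"
    let ?a = "\<lambda>\<xi>::'a. indicator (cball 0 A) \<xi> * norm \<xi> powr (- s) :: real"
    let ?b = "\<lambda>\<xi>. norm \<xi> powr s * norm (g \<xi>)"
    have [measurable]: "g \<in> borel_measurable borel" "ball_truncation A g \<in> borel_measurable borel"
      using g ball_truncation_square_integrable[OF g] by (auto dest: square_integrable_measurable)
    have b2: "(norm (?b \<xi>))\<^sup>2 = norm \<xi> powr (2 * s) * (norm (g \<xi>))\<^sup>2" for \<xi>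
      by (simp add: power_mult_distrib) (simp add: power2_eq_square flip: powr_add)
    have [measurable]: "cball (0::'a) A \<in> sets borel"
      by simp
    have b: "square_integrable ?b"
      unfolding square_integrable_def b2 using int by simp
    have lb: "l2 ?b = ?K"
      unfolding l2_def b2 ..
    have "(LINT \<xi>|lborel. norm (ball_truncation A g \<xi>)) = (LINT \<xi>|lborel. norm (?a \<xi> * ?b \<xi>))"
    proof (rule integral_cong_AE)
      \<comment> \<open>At the origin both powers are \<open>0\<close> and the factorisation may
        fail; that single point is null.\<close>
      show "AE \<xi> in lborel. norm (ball_truncation A g \<xi>) = norm (?a \<xi> * ?b \<xi>)"
        using AE_lborel_singleton[of 0]
        by eventually_elim
           (auto simp: ball_truncation_def indicator_def abs_mult mult.assoc[symmetric] simp flip: powr_add)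
    qed measurable
    also have "\<dots> \<le> sqrt (l2 ?a * l2 ?b)"
      by (intro real_le_rsqrt Cauchy_Schwarz_square_integrable a A b)
    also have "\<dots> \<le> sqrt (c * A powr (real DIM('a) - 2 * s) * ?K)"
      unfolding lb by (intro real_sqrt_le_mono mult_right_mono a A Bochner_Integration.integral_nonneg) auto
    finally show "(LINT \<xi>|lborel. norm (ball_truncation A g \<xi>)) \<le> sqrt (c * A powr (real DIM('a) - 2 * s) * ?K)" .
  qed
qed

text \<open>Where |f| > t, a low frequency part of size at most t/2 leaves a remainder of size at
  least t/2. Chebyshev at this threshold produces the factor 4/t^2.\<close>

lemma emeasure_superlevel_le:
  fixes f :: "'a::euclidean_space \<Rightarrow> complex"
  assumes f: "square_integrable f" and g: "has_fourier_L2 f g" and t: "t > 0"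
    and A: "(LINT \<xi>|lborel. norm (ball_truncation A g \<xi>)) \<le> t / 2"
  shows "emeasure lborel {x. t < norm (f x)} \<le>
    ennreal (4 / t\<^sup>2) * (\<integral>\<^sup>+\<xi>. (if A < norm \<xi> then ennreal ((norm (g \<xi>))\<^sup>2) else 0) \<partial>lborel)"
proof -
  obtain v where v: "square_integrable v"
    and bd: "\<And>x. norm (v x) \<le> (LINT \<xi>|lborel. norm (ball_truncation A g \<xi>))"
    and l: "l2 (\<lambda>x. f x - v x) = l2 (\<lambda>\<xi>. g \<xi> - ball_truncation A g \<xi>)"
    using low_frequency_part[OF f g, of A] by blast
  have gs: "square_integrable g"
    using g by (rule has_fourier_L2_square_integrable)
  have [measurable]: "f \<in> borel_measurable borel" "v \<in> borel_measurable borel"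
    using f v by (auto dest: square_integrable_measurable)
  have "{x. t < norm (f x)} \<subseteq> {x \<in> UNIV. 1 \<le> ennreal (4 / t\<^sup>2) * ennreal ((norm (f x - v x))\<^sup>2)}"
  proof
    fix x assume "x \<in> {x. t < norm (f x)}"
    then have "t / 2 \<le> norm (f x - v x)"
      using bd[of x] A norm_triangle_ineq2[of "f x" "v x"] by simp
    then have "(t / 2)\<^sup>2 \<le> (norm (f x - v x))\<^sup>2"
      using t by (intro power_mono) auto
    then have "1 \<le> 4 / t\<^sup>2 * (norm (f x - v x))\<^sup>2"
      using t by (simp add: field_simps)
    then show "x \<in> {x \<in> UNIV. 1 \<le> ennreal (4 / t\<^sup>2) * ennreal ((norm (f x - v x))\<^sup>2)}"
      by (simp add: ennreal_mult[symmetric])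
  qed
  then have "emeasure lborel {x. t < norm (f x)}
      \<le> emeasure lborel {x \<in> UNIV. 1 \<le> ennreal (4 / t\<^sup>2) * ennreal ((norm (f x - v x))\<^sup>2)}"
    by (intro emeasure_mono) auto
  also have "\<dots> \<le> ennreal (4 / t\<^sup>2) * (\<integral>\<^sup>+x. ennreal ((norm (f x - v x))\<^sup>2) * indicator UNIV x \<partial>lborel)"
    by (rule nn_integral_Markov_inequality) auto
  also have "(\<integral>\<^sup>+x. ennreal ((norm (f x - v x))\<^sup>2) * indicator UNIV x \<partial>lborel)
      = (\<integral>\<^sup>+\<xi>. ennreal ((norm (g \<xi> - ball_truncation A g \<xi>))\<^sup>2) \<partial>lborel)"
    using nn_integral_eq_l2[OF square_integrable_diff[OF f v]] l
      nn_integral_eq_l2[OF square_integrable_diff[OF gs ball_truncation_square_integrable[OF gs, of A]]]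
    by simp
  also have "\<dots> = (\<integral>\<^sup>+\<xi>. (if A < norm \<xi> then ennreal ((norm (g \<xi>))\<^sup>2) else 0) \<partial>lborel)"
    by (intro nn_integral_cong) (auto simp: ball_truncation_def)
  finally show ?thesis .
qed

section \<open>Layer cake formula and integration over the levels\<close>

lemma nn_integral_powr_Ioo:
  assumes e: "e > -1" and c: "c \<ge> 0"
  shows "(\<integral>\<^sup>+t. (if 0 < t \<and> t < c then ennreal (t powr e) else 0) \<partial>lborel) = ennreal (c powr (e + 1) / (e + 1))"
proof -
  have "(\<integral>\<^sup>+t. (if 0 < t \<and> t < c then ennreal (t powr e) else 0) \<partial>lborel)
      = (\<integral>\<^sup>+t. ennreal (if t \<in> {0..c} then t powr e else 0) \<partial>lborel)"
    by (rule nn_integral_cong_AE, use AE_lborel_singleton[of 0] AE_lborel_singleton[of c] in eventually_elim)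
       (auto simp: indicator_def)
  also have "\<dots> = ennreal (c powr (e + 1) / (e + 1))"
    by (rule nn_integral_has_integral_lborel)
       (use has_integral_powr_from_0[OF e c] in \<open>auto simp del: atLeastAtMost_iff simp: has_integral_restrict_UNIV\<close>)
  finally show ?thesis .
qed

lemma nn_integral_layer_cake:
  fixes f :: "'a::euclidean_space \<Rightarrow> complex"
  assumes [measurable]: "f \<in> borel_measurable borel" and p: "p > 0"
  shows "(\<integral>\<^sup>+x. ennreal (norm (f x) powr p) \<partial>lborel) =
    (\<integral>\<^sup>+t. (if 0 < t then ennreal (p * t powr (p - 1)) * emeasure lborel {x. t < norm (f x)} else 0) \<partial>lborel)"
proof -
  have "(\<integral>\<^sup>+x. ennreal (norm (f x) powr p) \<partial>lborel)
      = (\<integral>\<^sup>+x. (\<integral>\<^sup>+t. (if 0 < t \<and> t < norm (f x) then ennreal (p * t powr (p - 1)) else 0) \<partial>lborel) \<partial>lborel)"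
  proof (rule nn_integral_cong)
    fix x
    have "(\<integral>\<^sup>+t. (if 0 < t \<and> t < norm (f x) then ennreal (p * t powr (p - 1)) else 0) \<partial>lborel)
        = (\<integral>\<^sup>+t. ennreal p * (if 0 < t \<and> t < norm (f x) then ennreal (t powr (p - 1)) else 0) \<partial>lborel)"
      using p by (intro nn_integral_cong) (auto simp: ennreal_mult)
    also have "\<dots> = ennreal p * ennreal (norm (f x) powr (p - 1 + 1) / (p - 1 + 1))"
      using p by (subst nn_integral_cmult) (auto simp: nn_integral_powr_Ioo)
    also have "\<dots> = ennreal (norm (f x) powr p)"
      using p by (simp add: ennreal_mult[symmetric])
    finally show "ennreal (norm (f x) powr p)
        = (\<integral>\<^sup>+t. (if 0 < t \<and> t < norm (f x) then ennreal (p * t powr (p - 1)) else 0) \<partial>lborel)" ..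
  qed
  also have "\<dots> = (\<integral>\<^sup>+t. (\<integral>\<^sup>+x. (if 0 < t \<and> t < norm (f x) then ennreal (p * t powr (p - 1)) else 0) \<partial>lborel) \<partial>lborel)"
    by (rule lborel_pair.Fubini'[symmetric]) measurable
  also have "\<dots> = (\<integral>\<^sup>+t. (if 0 < t then ennreal (p * t powr (p - 1)) * emeasure lborel {x. t < norm (f x)} else 0) \<partial>lborel)"
  proof (rule nn_integral_cong)
    fix t :: real
    have "(\<integral>\<^sup>+x. (if 0 < t \<and> t < norm (f x) then ennreal (p * t powr (p - 1)) else 0) \<partial>lborel)
       = (\<integral>\<^sup>+x. (if 0 < t then ennreal (p * t powr (p - 1)) else 0) * indicator {x. t < norm (f x)} x \<partial>lborel)"
      by (intro nn_integral_cong) (auto simp: indicator_def)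
    also have "\<dots> = (if 0 < t then ennreal (p * t powr (p - 1)) else 0) * emeasure lborel {x. t < norm (f x)}"
      by (rule nn_integral_cmult_indicator) measurable
    finally show "(\<integral>\<^sup>+x. (if 0 < t \<and> t < norm (f x) then ennreal (p * t powr (p - 1)) else 0) \<partial>lborel)
      = (if 0 < t then ennreal (p * t powr (p - 1)) * emeasure lborel {x. t < norm (f x)} else 0)"
      by simp
  qed
  finally show ?thesis .
qed

text \<open>This inverts the cut-off: a frequency of size \<open>r\<close> lies above the cut-off of
  level \<open>t\<close> exactly when \<open>t\<close> lies below
  \<open>b * r powr \<kappa>\<close>. After the exchange of integrals, t then runs over an interval
  starting at 0.\<close>

lemma powr_less_swap_iff:
  fixes t b r \<kappa> :: real
  assumes "t > 0" "b > 0" "\<kappa> > 0" "r \<ge> 0"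
  shows "(t / b) powr (1 / \<kappa>) < r \<longleftrightarrow> t < b * r powr \<kappa>"
proof
  assume "(t / b) powr (1 / \<kappa>) < r"
  then have "((t / b) powr (1 / \<kappa>)) powr \<kappa> < r powr \<kappa>"
    using assms by (intro powr_less_mono2) auto
  then show "t < b * r powr \<kappa>"
    using assms by (simp add: powr_powr field_simps)
next
  assume *: "t < b * r powr \<kappa>"
  then have "r > 0"
    using assms by (cases "r = 0") auto
  have "(t / b) powr (1 / \<kappa>) < (r powr \<kappa>) powr (1 / \<kappa>)"
    using assms * by (intro powr_less_mono2) (auto simp: field_simps)
  then show "(t / b) powr (1 / \<kappa>) < r"
    using assms \<open>r > 0\<close> by (simp add: powr_powr)
qed

lemma critical_exponent_gt_2:
  assumes "0 < s" "2 * s < real N"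
  shows "critical_exponent N s > 2"
  using assms by (simp add: critical_exponent_def field_simps)

text \<open>The one place where the value of the critical exponent matters: integrating over the
  levels returns precisely the weight |\<xi>|^(2s).\<close>

lemma critical_exponent_minus_2:
  assumes "2 * s < real N"
  shows "(real N - 2 * s) / 2 * (critical_exponent N s - 2) = 2 * s"
  using assms by (simp add: critical_exponent_def field_simps)

text \<open>The case of positive \<open>K\<close>, in which the cut-off can be defined by a division
  by a multiple of sqrt K.\<close>

lemma sobolev_pos:
  fixes f :: "'a::euclidean_space \<Rightarrow> complex" and s :: real
  defines "p \<equiv> critical_exponent DIM('a) s"
  assumes s: "0 < s" "2 * s < real DIM('a)" and f: "square_integrable f" and g: "has_fourier_L2 f g"
    and int: "integrable lborel (\<lambda>\<xi>. norm \<xi> powr (2 * s) * (norm (g \<xi>))\<^sup>2)"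
    and K: "K = (LINT \<xi>|lborel. norm \<xi> powr (2 * s) * (norm (g \<xi>))\<^sup>2)" "K > 0"
    and c: "c > 0" "\<And>A. A > 0 \<Longrightarrow> (LINT \<xi>|lborel. norm (ball_truncation A g \<xi>)) \<le>
        sqrt (c * A powr (real DIM('a) - 2 * s) * K)"
  shows "(\<integral>\<^sup>+x. ennreal (norm (f x) powr p) \<partial>lborel)
    \<le> ennreal (4 * p / (p - 2) * (2 * sqrt c) powr (p - 2) * K powr (p / 2))"
proof -
  \<comment> \<open>\<open>A t\<close> is the solution of sqrt (c A^(2\<kappa>) K) = t/2, so the low
    frequency bound becomes exactly half the level.\<close>
  define b where "b = 2 * sqrt (c * K)"
  define \<kappa> where "\<kappa> = (real DIM('a) - 2 * s) / 2"
  define A where "A t = (t / b) powr (1 / \<kappa>)" for t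
  have b: "b > 0" and \<kappa>: "\<kappa> > 0"
    using c(1) K(2) s by (auto simp: b_def \<kappa>_def)
  have \<kappa>2: "\<kappa> * 2 = real DIM('a) - 2 * s"
    unfolding \<kappa>_def by (simp add: field_simps)
  have p: "p > 2" and \<kappa>p: "\<kappa> * (p - 2) = 2 * s"
    using critical_exponent_gt_2[OF s] critical_exponent_minus_2[OF s(2)] by (auto simp: p_def \<kappa>_def)
  have gs: "square_integrable g"
    using g by (rule has_fourier_L2_square_integrable)
  have [measurable]: "f \<in> borel_measurable borel" "g \<in> borel_measurable borel"
    using f gs by (auto dest: square_integrable_measurable)
  have [measurable]: "A \<in> borel_measurable borel"
    unfolding A_def by measurable
  have Abd: "(LINT \<xi>|lborel. norm (ball_truncation (A t) g \<xi>)) \<le> t / 2" if t: "t > 0" for t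
  proof -
    have "A t powr (real DIM('a) - 2 * s) = (A t powr \<kappa>) powr 2"
      unfolding powr_powr using \<kappa>2 by simp
    also have "A t powr \<kappa> = t / b"
      using t b \<kappa> by (simp add: A_def powr_powr)
    also have "(t / b) powr 2 = (t / b)\<^sup>2"
      using t b by (simp add: powr_numeral)
    finally have *: "A t powr (real DIM('a) - 2 * s) = (t / b)\<^sup>2" .
    have "c * K = (b / 2)\<^sup>2"
      using c(1) K(2) by (simp add: b_def)
    then have "c * (t / b)\<^sup>2 * K = (t / 2)\<^sup>2"
      using b by (simp add: field_simps power2_eq_square)
    then have "sqrt (c * (t / b)\<^sup>2 * K) = t / 2"
      using t by simp
    moreover have "A t > 0"
      using t b by (simp add: A_def)
    ultimately show ?thesis
      using c(2)[of "A t"] * by simp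
  qed
  let ?G = "\<lambda>\<xi>. ennreal ((norm (g \<xi>))\<^sup>2)"
  have "(\<integral>\<^sup>+x. ennreal (norm (f x) powr p) \<partial>lborel)
     = (\<integral>\<^sup>+t. (if 0 < t then ennreal (p * t powr (p - 1)) * emeasure lborel {x. t < norm (f x)} else 0) \<partial>lborel)"
    using p by (intro nn_integral_layer_cake) auto
  also have "\<dots> \<le> (\<integral>\<^sup>+t. (if 0 < t then ennreal (p * t powr (p - 1)) * (ennreal (4 / t\<^sup>2) *
      (\<integral>\<^sup>+\<xi>. (if A t < norm \<xi> then ?G \<xi> else 0) \<partial>lborel)) else 0) \<partial>lborel)"
    using emeasure_superlevel_le[OF f g _ Abd] by (intro nn_integral_mono) (auto intro!: mult_left_mono)
  also have "\<dots> = (\<integral>\<^sup>+t. (\<integral>\<^sup>+\<xi>. (if 0 < t \<and> A t < norm \<xi> then ennreal (4 * p * t powr (p - 3)) * ?G \<xi> else 0) \<partial>lborel) \<partial>lborel)"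
  proof (rule nn_integral_cong)
    fix t :: real
    show "(if 0 < t then ennreal (p * t powr (p - 1)) * (ennreal (4 / t\<^sup>2) *
        (\<integral>\<^sup>+\<xi>. (if A t < norm \<xi> then ?G \<xi> else 0) \<partial>lborel)) else 0)
      = (\<integral>\<^sup>+\<xi>. (if 0 < t \<and> A t < norm \<xi> then ennreal (4 * p * t powr (p - 3)) * ?G \<xi> else 0) \<partial>lborel)"
    proof (cases "0 < t")
      case True
      \<comment> \<open>The Chebyshev factor lowers the exponent to p - 3, which exceeds -1 because
        p > 2; the integral over small levels therefore converges.\<close>
      have "t powr (p - 1) = t powr (p - 3) * t\<^sup>2"
        using True by (simp flip: powr_numeral powr_add)
      then have "ennreal (p * t powr (p - 1)) * ennreal (4 / t\<^sup>2) = ennreal (4 * p * t powr (p - 3))"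
        using True p by (subst ennreal_mult[symmetric]) auto
      moreover have "(\<integral>\<^sup>+\<xi>. (if A t < norm \<xi> then ennreal (4 * p * t powr (p - 3)) * ?G \<xi> else 0) \<partial>lborel)
         = (\<integral>\<^sup>+\<xi>. ennreal (4 * p * t powr (p - 3)) * (if A t < norm \<xi> then ?G \<xi> else 0) \<partial>lborel)"
        by (intro nn_integral_cong) auto
      ultimately show ?thesis
        using True by (simp add: nn_integral_cmult mult.assoc[symmetric])
    qed simp
  qed
  also have "\<dots> = (\<integral>\<^sup>+\<xi>. (\<integral>\<^sup>+t. (if 0 < t \<and> A t < norm \<xi> then ennreal (4 * p * t powr (p - 3)) * ?G \<xi> else 0) \<partial>lborel) \<partial>lborel)"
    by (rule lborel_pair.Fubini'[symmetric]) measurable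
  also have "\<dots> = (\<integral>\<^sup>+\<xi>. ennreal (4 * p / (p - 2) * b powr (p - 2)) * ennreal (norm \<xi> powr (2 * s) * (norm (g \<xi>))\<^sup>2) \<partial>lborel)"
  proof (rule nn_integral_cong)
    fix \<xi> :: 'a
    have "(\<integral>\<^sup>+t. (if 0 < t \<and> A t < norm \<xi> then ennreal (4 * p * t powr (p - 3)) * ?G \<xi> else 0) \<partial>lborel)
       = (\<integral>\<^sup>+t. (ennreal (4 * p) * ?G \<xi>) * (if 0 < t \<and> t < b * norm \<xi> powr \<kappa> then ennreal (t powr (p - 3)) else 0) \<partial>lborel)"
      using powr_less_swap_iff[OF _ b \<kappa> norm_ge_zero, of _ \<xi>] p
      by (intro nn_integral_cong) (auto simp: A_def ennreal_mult mult_ac)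
    also have "\<dots> = (ennreal (4 * p) * ?G \<xi>) * ennreal ((b * norm \<xi> powr \<kappa>) powr (p - 3 + 1) / (p - 3 + 1))"
      using p b by (subst nn_integral_cmult) (auto simp: nn_integral_powr_Ioo)
    also have "p - 3 + 1 = p - 2"
      by simp
    also have "(b * norm \<xi> powr \<kappa>) powr (p - 2) = b powr (p - 2) * norm \<xi> powr (2 * s)"
      using b by (simp add: powr_mult powr_powr \<kappa>p)
    also have "(ennreal (4 * p) * ?G \<xi>) * ennreal (b powr (p - 2) * norm \<xi> powr (2 * s) / (p - 2))
       = ennreal (4 * p / (p - 2) * b powr (p - 2)) * ennreal (norm \<xi> powr (2 * s) * (norm (g \<xi>))\<^sup>2)"
      using p by (simp add: ennreal_mult[symmetric] mult_ac)
    finally show "(\<integral>\<^sup>+t. (if 0 < t \<and> A t < norm \<xi> then ennreal (4 * p * t powr (p - 3)) * ?G \<xi> else 0) \<partial>lborel)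
       = ennreal (4 * p / (p - 2) * b powr (p - 2)) * ennreal (norm \<xi> powr (2 * s) * (norm (g \<xi>))\<^sup>2)" .
  qed
  also have "\<dots> = ennreal (4 * p / (p - 2) * b powr (p - 2)) * ennreal K"
    unfolding K(1) by (subst nn_integral_cmult) (auto simp: nn_integral_eq_integral[OF int])
  also have "\<dots> = ennreal (4 * p / (p - 2) * b powr (p - 2) * K)"
    using p K(2) by (subst ennreal_mult[symmetric]) auto
  \<comment> \<open>The factor b^(p-2) contributes K^(p/2 - 1) and the frequency integral one more
    K, giving the power p/2 that homogeneity demands.\<close>
  also have "b powr (p - 2) = (2 * sqrt c) powr (p - 2) * K powr (p / 2 - 1)"
  proof -
    have "sqrt K powr (p - 2) = K powr (p / 2 - 1)"
      using K(2) by (simp add: powr_half_sqrt[symmetric] powr_powr diff_divide_distrib)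
    then show ?thesis
      using c(1) K(2) by (simp add: b_def real_sqrt_mult powr_mult)
  qed
  also have "4 * p / (p - 2) * ((2 * sqrt c) powr (p - 2) * K powr (p / 2 - 1)) * K
      = 4 * p / (p - 2) * (2 * sqrt c) powr (p - 2) * (K powr (p / 2 - 1) * K)"
    by (simp only: mult.assoc)
  also have "K powr (p / 2 - 1) * K = K powr (p / 2)"
    using K(2) powr_mult_base[of K "p / 2 - 1"] by (simp add: mult.commute)
  finally show ?thesis .
qed

text \<open>The weight vanishes at most at the origin, so the transform is zero almost everywhere
  and Plancherel carries this back to \<open>f\<close>. It settles the degenerate case
  \<open>K = 0\<close>.\<close>

lemma has_fourier_L2_zero_weighted:
  fixes f :: "'a::euclidean_space \<Rightarrow> complex"
  assumes f: "square_integrable f" and g: "has_fourier_L2 f g"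
    and int: "integrable lborel (\<lambda>\<xi>. norm \<xi> powr r * (norm (g \<xi>))\<^sup>2)"
    and zero: "(LINT \<xi>|lborel. norm \<xi> powr r * (norm (g \<xi>))\<^sup>2) = 0"
  shows "AE x in lborel. f x = 0"
proof -
  have "AE \<xi> in lborel. norm \<xi> powr r * (norm (g \<xi>))\<^sup>2 = 0"
    using zero by (subst (asm) integral_nonneg_eq_0_iff_AE[OF int]) auto
  then have "AE \<xi> in lborel. g \<xi> = 0"
    using AE_lborel_singleton[of 0] by eventually_elim auto
  then have "l2 g = 0"
    using l2_eq_0_iff[OF has_fourier_L2_square_integrable[OF g]] by simp
  then show ?thesis
    using Plancherel[OF f g] l2_eq_0_iff[OF f] by simp
qed

text \<open>Integrability is stated next to the estimate because a divergent Bochner integral would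
  be \<open>0\<close> and the estimate alone would say nothing.\<close>

theorem fractional_Sobolev_inequality:
  fixes s :: real
  defines "p \<equiv> critical_exponent DIM('a::euclidean_space) s"
  assumes s: "0 < s" "2 * s < real DIM('a)"
  shows "\<exists>C>0. \<forall>(f :: 'a \<Rightarrow> complex) g. square_integrable f \<longrightarrow> has_fourier_L2 f g \<longrightarrow>
      integrable lborel (\<lambda>\<xi>. norm \<xi> powr (2 * s) * (norm (g \<xi>))\<^sup>2) \<longrightarrow>
      integrable lborel (\<lambda>x. norm (f x) powr p) \<and>
      (LINT x|lborel. norm (f x) powr p) \<le> C * (LINT \<xi>|lborel. norm \<xi> powr (2 * s) * (norm (g \<xi>))\<^sup>2) powr (p / 2)"
proof -
  obtain c where c: "c > 0"
    and bd: "\<And>(g :: 'a \<Rightarrow> complex) A. square_integrable g \<Longrightarrow>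
      integrable lborel (\<lambda>\<xi>. norm \<xi> powr (2 * s) * (norm (g \<xi>))\<^sup>2) \<Longrightarrow> A > 0 \<Longrightarrow>
      (LINT \<xi>|lborel. norm (ball_truncation A g \<xi>)) \<le>
        sqrt (c * A powr (real DIM('a) - 2 * s) * (LINT \<xi>|lborel. norm \<xi> powr (2 * s) * (norm (g \<xi>))\<^sup>2))"
    using integral_norm_ball_truncation_le[OF s] by blast
  have p: "p > 2"
    using critical_exponent_gt_2[OF s] by (simp add: p_def)
  define C where "C = 4 * p / (p - 2) * (2 * sqrt c) powr (p - 2)"
  have C: "C > 0"
    using p c by (simp add: C_def)
  show ?thesis
  proof (intro exI[of _ C] conjI C allI impI)
    fix f g :: "'a \<Rightarrow> complex"
    assume f: "square_integrable f" and g: "has_fourier_L2 f g"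
      and int: "integrable lborel (\<lambda>\<xi>. norm \<xi> powr (2 * s) * (norm (g \<xi>))\<^sup>2)"
    define K where "K = (LINT \<xi>|lborel. norm \<xi> powr (2 * s) * (norm (g \<xi>))\<^sup>2)"
    have [measurable]: "f \<in> borel_measurable borel"
      using f by (auto dest: square_integrable_measurable)
    have "K \<ge> 0"
      by (simp add: K_def)
    have le: "(\<integral>\<^sup>+x. ennreal (norm (f x) powr p) \<partial>lborel) \<le> ennreal (C * K powr (p / 2))"
    proof (cases "K = 0")
      case True
      have "AE x in lborel. f x = 0"
        by (rule has_fourier_L2_zero_weighted[OF f g int]) (use True in \<open>simp add: K_def\<close>)
      then have "(\<integral>\<^sup>+x. ennreal (norm (f x) powr p) \<partial>lborel) = (\<integral>\<^sup>+x. 0 \<partial>(lborel :: 'a measure))"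
        by (intro nn_integral_cong_AE) (auto elim!: eventually_mono)
      then show ?thesis by simp
    next
      case False
      then have K: "K > 0"
        using \<open>K \<ge> 0\<close> by simp
      show ?thesis
        using sobolev_pos[OF s f g int K_def K c] bd[OF has_fourier_L2_square_integrable[OF g] int]
        by (simp add: K_def[symmetric] C_def p_def)
    qed
    show integrable: "integrable lborel (\<lambda>x. norm (f x) powr p)"
      using le by (intro integrableI_nonneg) (auto intro: le_less_trans)
    have "ennreal (LINT x|lborel. norm (f x) powr p) \<le> ennreal (C * K powr (p / 2))"
      using le by (subst nn_integral_eq_integral[OF integrable, symmetric]) auto
    then show "(LINT x|lborel. norm (f x) powr p)
        \<le> C * (LINT \<xi>|lborel. norm \<xi> powr (2 * s) * (norm (g \<xi>))\<^sup>2) powr (p / 2)"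
      using C by (simp add: K_def[symmetric] ennreal_le_iff)
  qed
qed

subsection \<open>The two quotients\<close>

text \<open>Allowing mass zero puts both quotients into one family: S is the case
  \<open>m = 0\<close>.\<close>

definition symbol :: "real \<Rightarrow> real \<Rightarrow> 'a::euclidean_space \<Rightarrow> real" where
  "symbol m s \<xi> = (m\<^sup>2 + 4 * pi\<^sup>2 * (norm \<xi>)\<^sup>2) powr s"

lemma symbol_nonneg [simp]: "symbol m s \<xi> \<ge> 0"
  by (simp add: symbol_def)

lemma measurable_symbol [measurable]: "symbol m s \<in> borel_measurable borel"
  unfolding symbol_def by measurable

lemma symbol_mono: "0 < s \<Longrightarrow> \<bar>m\<bar> \<le> \<bar>m'\<bar> \<Longrightarrow> symbol m s \<xi> \<le> symbol m' s \<xi>"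
  unfolding symbol_def by (intro powr_mono2 add_mono) (auto simp: abs_le_square_iff[symmetric])

lemma symbol_strict: "0 < s \<Longrightarrow> 0 < m \<Longrightarrow> symbol 0 s \<xi> < symbol m s \<xi>"
  unfolding symbol_def by (intro powr_less_mono2) auto

lemma symbol_zero: "symbol 0 s \<xi> = (2 * pi * norm \<xi>) powr (2 * s)"
proof -
  have "(2 * pi * norm \<xi>) powr (2 * s) = ((2 * pi * norm \<xi>) powr 2) powr s"
    by (simp only: powr_powr)
  also have "(2 * pi * norm \<xi>) powr 2 = 4 * pi\<^sup>2 * (norm \<xi>)\<^sup>2"
    by (simp add: powr_numeral power_mult_distrib)
  finally show ?thesis
    by (simp add: symbol_def)
qed

lemma symbol_scale:
  assumes "c > 0"
  shows "symbol m s (c *\<^sub>R \<xi>) = c powr (2 * s) * symbol (m / c) s \<xi>"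
proof -
  have "m\<^sup>2 + 4 * pi\<^sup>2 * (norm (c *\<^sub>R \<xi>))\<^sup>2 = c powr 2 * ((m / c)\<^sup>2 + 4 * pi\<^sup>2 * (norm \<xi>)\<^sup>2)"
    using assms by (simp add: power_mult_distrib power_divide field_simps)
  then show ?thesis
    unfolding symbol_def by (simp add: powr_mult powr_powr)
qed

lemma Lambda_quotient_symbol:
  fixes u :: "'a::euclidean_space \<Rightarrow> real"
  shows "Lambda_quotient m s u = (LINT \<xi>|lborel. symbol m s \<xi> * (norm (fourier_L2 u \<xi>))\<^sup>2)
     / (LINT x|lborel. \<bar>u x\<bar> powr critical_exponent DIM('a) s) powr (2 / critical_exponent DIM('a) s)"
  by (simp add: Lambda_quotient_def symbol_def)

lemma S_quotient_eq_Lambda_quotient: "S_quotient s u = Lambda_quotient 0 s u"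
  by (simp add: S_quotient_def Lambda_quotient_symbol symbol_zero)

lemma
  assumes "square_integrable u"
  shows square_integrable_fourier_L2: "square_integrable (fourier_L2 u)"
    and square_integrable_of_real: "square_integrable (\<lambda>x. complex_of_real (u x))"
proof -
  have [measurable]: "u \<in> borel_measurable borel"
    using assms by (auto dest: square_integrable_measurable)
  show "square_integrable (\<lambda>x. complex_of_real (u x))"
    by (rule square_integrable_mono[OF assms]) auto
  show "square_integrable (fourier_L2 u)"
    by (rule has_fourier_L2_square_integrable[OF has_fourier_L2_fourier_L2[OF assms]])
qed

lemma Hs_iff:
  "u \<in> Hs m s \<longleftrightarrow> square_integrable u \<and> integrable lborel (\<lambda>\<xi>. symbol m s \<xi> * (norm (fourier_L2 u \<xi>))\<^sup>2)"
proof (cases "square_integrable u")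
  case True
  have [measurable]: "fourier_L2 u \<in> borel_measurable borel"
    using square_integrable_fourier_L2[OF True] by (auto dest: square_integrable_measurable)
  have "integrable lborel (\<lambda>\<xi>. symbol m s \<xi> * (norm (fourier_L2 u \<xi>))\<^sup>2) \<longleftrightarrow>
      (\<integral>\<^sup>+\<xi>. ennreal (symbol m s \<xi> * (norm (fourier_L2 u \<xi>))\<^sup>2) \<partial>lborel) < \<infinity>"
    by (simp add: integrable_iff_bounded)
  then show ?thesis
    using True by (simp add: Hs_def symbol_def)
qed (simp add: Hs_def)

text \<open>The symbol increases with the mass, so membership for mass \<open>m\<close> makes all
  numerators of smaller mass finite, in particular those of S and of the dilated functions.\<close>

lemma Hs_integrable_symbol:
  assumes u: "u \<in> Hs m s" and s: "0 < s" and m: "\<bar>m'\<bar> \<le> \<bar>m\<bar>"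
  shows "integrable lborel (\<lambda>\<xi>. symbol m' s \<xi> * (norm (fourier_L2 u \<xi>))\<^sup>2)"
proof -
  have sq: "square_integrable u" and int: "integrable lborel (\<lambda>\<xi>. symbol m s \<xi> * (norm (fourier_L2 u \<xi>))\<^sup>2)"
    using u by (auto simp: Hs_iff)
  have [measurable]: "fourier_L2 u \<in> borel_measurable borel"
    using square_integrable_fourier_L2[OF sq] by (auto dest: square_integrable_measurable)
  show ?thesis
    by (rule Bochner_Integration.integrable_bound[OF int])
       (auto simp: abs_mult intro!: mult_right_mono symbol_mono s m)
qed

lemma Hs_nonzero_bounds:
  fixes s m :: real
  assumes s: "0 < s" "2 * s < real DIM('a::euclidean_space)" and m: "m > 0"
  shows "\<exists>c>0. \<forall>u \<in> (Hs_nonzero m s :: ('a \<Rightarrow> real) set).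
    c \<le> S_quotient s u \<and> S_quotient s u < Lambda_quotient m s u"
proof -
  let ?p = "critical_exponent DIM('a) s"
  have p: "?p > 2"
    by (rule critical_exponent_gt_2[OF s])
  obtain C where C: "C > 0" and sob: "\<And>(f :: 'a \<Rightarrow> complex) g. square_integrable f \<Longrightarrow> has_fourier_L2 f g \<Longrightarrow>
      integrable lborel (\<lambda>\<xi>. norm \<xi> powr (2 * s) * (norm (g \<xi>))\<^sup>2) \<Longrightarrow>
      integrable lborel (\<lambda>x. norm (f x) powr ?p) \<and>
      (LINT x|lborel. norm (f x) powr ?p) \<le> C * (LINT \<xi>|lborel. norm \<xi> powr (2 * s) * (norm (g \<xi>))\<^sup>2) powr (?p / 2)"
    using fractional_Sobolev_inequality[OF s] by blast
  \<comment> \<open>This is the Sobolev estimate raised to the power 2/p; the factor (2 pi)^(2s)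
    converts |\<xi>|^(2s) into the massless symbol.\<close>
  define c where "c = (2 * pi) powr (2 * s) / C powr (2 / ?p)"
  have c: "c > 0"
    using C by (simp add: c_def)
  show ?thesis
  proof (intro exI[of _ c] conjI c ballI)
    fix u :: "'a \<Rightarrow> real"
    assume "u \<in> Hs_nonzero m s"
    then have u: "u \<in> Hs m s" and nz: "\<not> (AE x in lborel. u x = 0)"
      by (auto simp: Hs_nonzero_def)
    define g where "g = fourier_L2 u"
    define D where "D = (LINT x|lborel. \<bar>u x\<bar> powr ?p)"
    define I where "I m = (LINT \<xi>|lborel. symbol m s \<xi> * (norm (g \<xi>))\<^sup>2)" for m
    have sq: "square_integrable u"
      using u by (simp add: Hs_iff)
    note f = square_integrable_of_real[OF sq]
    have hg: "has_fourier_L2 (\<lambda>x. complex_of_real (u x)) g"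
      unfolding g_def by (rule has_fourier_L2_fourier_L2[OF sq])
    have int0: "integrable lborel (\<lambda>\<xi>. symbol 0 s \<xi> * (norm (g \<xi>))\<^sup>2)"
      and intm: "integrable lborel (\<lambda>\<xi>. symbol m s \<xi> * (norm (g \<xi>))\<^sup>2)"
      unfolding g_def by (intro Hs_integrable_symbol[OF u s(1)]; simp)+
    define a where "a = (2 * pi) powr (2 * s)"
    have a: "a > 0" by (simp add: a_def)
    have sym0: "norm \<xi> powr (2 * s) = symbol 0 s \<xi> / a" for \<xi> :: 'a
      unfolding symbol_zero a_def by (simp add: powr_mult)
    have K: "integrable lborel (\<lambda>\<xi>. norm \<xi> powr (2 * s) * (norm (g \<xi>))\<^sup>2)"
      "(LINT \<xi>|lborel. norm \<xi> powr (2 * s) * (norm (g \<xi>))\<^sup>2) = I 0 / a"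
      unfolding sym0 I_def using int0 by simp_all
    have I0: "I 0 \<ge> 0"
      by (simp add: I_def)
    have D: "integrable lborel (\<lambda>x. \<bar>u x\<bar> powr ?p)" "D \<le> C * (I 0 / a) powr (?p / 2)"
      using sob[OF f hg K(1)] K(2) by (auto simp: D_def)
    \<comment> \<open>Vanishing of the Bochner integral gives \<open>u = 0\<close> almost everywhere
      only because the Sobolev inequality has made the integrand integrable.\<close>
    have "D \<noteq> 0"
    proof
      assume "D = 0"
      then have "AE x in lborel. \<bar>u x\<bar> powr ?p = 0"
        unfolding D_def by (subst (asm) integral_nonneg_eq_0_iff_AE[OF D(1)]) auto
      with nz show False
        by simp
    qed
    moreover have "D \<ge> 0"
      by (simp add: D_def)
    ultimately have D0: "D > 0"
      by simp
    have S: "S_quotient s u = I 0 / D powr (2 / ?p)" and L: "Lambda_quotient m s u = I m / D powr (2 / ?p)"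
      unfolding S_quotient_eq_Lambda_quotient Lambda_quotient_symbol I_def D_def g_def by simp_all
    have "D powr (2 / ?p) \<le> (C * (I 0 / a) powr (?p / 2)) powr (2 / ?p)"
      using D(2) D0 p by (intro powr_mono2) auto
    also have "\<dots> = C powr (2 / ?p) * (I 0 / a)"
      using C I0 a p by (simp add: powr_mult powr_powr)
    finally have "D powr (2 / ?p) \<le> C powr (2 / ?p) * (I 0 / a)" .
    then have "c * D powr (2 / ?p) \<le> c * (C powr (2 / ?p) * (I 0 / a))"
      using c by (intro mult_left_mono) auto
    also have "\<dots> = I 0"
      using C a by (simp add: c_def a_def[symmetric])
    finally show "c \<le> S_quotient s u"
      unfolding S using D0 by (simp add: pos_le_divide_eq)
    have int_diff: "integrable lborel (\<lambda>\<xi>. (symbol m s \<xi> - symbol 0 s \<xi>) * (norm (g \<xi>))\<^sup>2)"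
      using intm int0 by (simp add: left_diff_distrib)
    have diff: "(LINT \<xi>|lborel. (symbol m s \<xi> - symbol 0 s \<xi>) * (norm (g \<xi>))\<^sup>2) = I m - I 0"
      using intm int0 by (simp add: left_diff_distrib I_def)
    have pos: "symbol m s \<xi> - symbol 0 s \<xi> > 0" for \<xi> :: 'a
      using symbol_strict[OF s(1) m] by simp
    have nonneg: "0 \<le> (symbol m s \<xi> - symbol 0 s \<xi>) * (norm (g \<xi>))\<^sup>2" for \<xi> :: 'a
      by (intro mult_nonneg_nonneg less_imp_le[OF pos]) simp
    \<comment> \<open>The difference of the symbols is positive at every frequency, the origin
      included, so a zero integral would force the transform, and by Plancherel \<open>u\<close>, to
      vanish.\<close>
    have "I m - I 0 \<noteq> 0"
    proof
      assume "I m - I 0 = 0"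
      then have "AE \<xi> in lborel. (symbol m s \<xi> - symbol 0 s \<xi>) * (norm (g \<xi>))\<^sup>2 = 0"
        unfolding diff[symmetric]
        by (subst (asm) integral_nonneg_eq_0_iff_AE[OF int_diff]) (simp_all only: nonneg AE_I2)
      then have "AE \<xi> in lborel. g \<xi> = 0"
      proof eventually_elim
        case (elim \<xi>)
        with pos[of \<xi>] show ?case by auto
      qed
      then have "l2 g = 0"
        using l2_eq_0_iff[OF has_fourier_L2_square_integrable[OF hg]] by simp
      then have "AE x in lborel. complex_of_real (u x) = 0"
        using Plancherel[OF f hg] l2_eq_0_iff[OF f] by simp
      with nz show False by simp
    qed
    moreover have "I m - I 0 \<ge> 0"
      unfolding diff[symmetric] by (intro Bochner_Integration.integral_nonneg nonneg)
    ultimately show "S_quotient s u < Lambda_quotient m s u"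
      unfolding S L using D0 by (intro divide_strict_right_mono) auto
  qed
qed

text \<open>Dilation multiplies the numerator by c^(2s - N), after replacing m by m/c, and the
  denominator by c^(-2N/p). These factors agree because 2N/p = N - 2s. The condition
  \<open>c \<ge> 1\<close> keeps the new mass below \<open>m\<close>, where the numerator is known
  to be finite.\<close>

lemma
  fixes u :: "'a::euclidean_space \<Rightarrow> real"
  assumes s: "0 < s" "2 * s < real DIM('a)" and u: "u \<in> Hs_nonzero m s" and c: "c \<ge> 1"
  shows Hs_nonzero_scale: "(\<lambda>x. u (c *\<^sub>R x)) \<in> Hs_nonzero m s"
    and Lambda_quotient_scale: "Lambda_quotient m s (\<lambda>x. u (c *\<^sub>R x)) = Lambda_quotient (m / c) s u"
proof -
  let ?p = "critical_exponent DIM('a) s"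
  let ?N = "real DIM('a)"
  let ?v = "\<lambda>x. u (c *\<^sub>R x)"
  define g where "g = fourier_L2 u"
  define h where "h \<xi> = g (\<xi> /\<^sub>R c) / of_real (c ^ DIM('a))" for \<xi>
  have c0: "c > 0" using c by simp
  have uH: "u \<in> Hs m s" and nz: "\<not> (AE x in lborel. u x = 0)"
    using u by (auto simp: Hs_nonzero_def)
  have sq: "square_integrable u"
    using uH by (simp add: Hs_iff)
  have sqv: "square_integrable ?v"
    by (rule square_integrable_scale[OF sq c0])
  have gs: "square_integrable g"
    unfolding g_def by (rule square_integrable_fourier_L2[OF sq])
  have [measurable]: "u \<in> borel_measurable borel" "g \<in> borel_measurable borel" "?v \<in> borel_measurable borel"
      "fourier_L2 ?v \<in> borel_measurable borel"
    using sq gs sqv square_integrable_fourier_L2[OF sqv] by (auto dest: square_integrable_measurable)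
  have [measurable]: "h \<in> borel_measurable borel"
    unfolding h_def by measurable
  have hv: "has_fourier_L2 (\<lambda>x. complex_of_real (?v x)) h"
    unfolding h_def g_def
    by (rule has_fourier_L2_scale[OF square_integrable_of_real[OF sq] has_fourier_L2_fourier_L2[OF sq] c0])
  \<comment> \<open>The transform of the dilate is a separate choice, so it agrees with the dilated
    transform only almost everywhere.\<close>
  have AE_h: "AE \<xi> in lborel. fourier_L2 ?v \<xi> = h \<xi>"
    by (rule has_fourier_L2_unique[OF square_integrable_of_real[OF sqv] has_fourier_L2_fourier_L2[OF sqv] hv])
  let ?k = "c powr (2 * s) / (c ^ DIM('a))\<^sup>2"
  have hk: "symbol m s \<xi> * (norm (h \<xi>))\<^sup>2 = ?k * (symbol (m / c) s (inverse c *\<^sub>R \<xi>) * (norm (g (inverse c *\<^sub>R \<xi>)))\<^sup>2)" for \<xi>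
    using symbol_scale[OF c0, of m s "inverse c *\<^sub>R \<xi>"] c0
    by (simp add: h_def norm_divide norm_power power_divide)
  have "\<bar>m\<bar> / c \<le> \<bar>m\<bar> / 1"
    using c by (intro divide_left_mono) auto
  then have "\<bar>m / c\<bar> \<le> \<bar>m\<bar>"
    using c0 by (simp add: abs_divide)
  then have int: "integrable lborel (\<lambda>\<xi>. symbol (m / c) s \<xi> * (norm (g \<xi>))\<^sup>2)"
    unfolding g_def by (rule Hs_integrable_symbol[OF uH s(1)])
  have int': "integrable lborel (\<lambda>\<xi>. symbol m s \<xi> * (norm (h \<xi>))\<^sup>2)"
    unfolding hk using integrable_lborel_affine[OF int, of "inverse c" 0] c0
    by (intro integrable_mult_right) simp
  have "integrable lborel (\<lambda>\<xi>. symbol m s \<xi> * (norm (fourier_L2 ?v \<xi>))\<^sup>2) \<longleftrightarrow>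
      integrable lborel (\<lambda>\<xi>. symbol m s \<xi> * (norm (h \<xi>))\<^sup>2)"
    by (rule integrable_cong_AE) (use AE_h in \<open>auto elim!: eventually_mono\<close>)
  then have vH: "?v \<in> Hs m s"
    using int' sqv by (simp add: Hs_iff)
  have "\<not> (AE x in lborel. ?v x = 0)"
  proof
    assume "AE x in lborel. ?v x = 0"
    then have "l2 u = 0"
      using l2_eq_0_iff[OF sqv] l2_scale[OF sq c0] c0 by simp
    with nz show False
      using l2_eq_0_iff[OF sq] by simp
  qed
  with vH show "?v \<in> Hs_nonzero m s"
    by (simp add: Hs_nonzero_def)
  let ?I = "LINT \<xi>|lborel. symbol (m / c) s \<xi> * (norm (g \<xi>))\<^sup>2"
  let ?D = "LINT x|lborel. \<bar>u x\<bar> powr ?p"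
  have "(LINT \<xi>|lborel. symbol m s \<xi> * (norm (fourier_L2 ?v \<xi>))\<^sup>2) = (LINT \<xi>|lborel. symbol m s \<xi> * (norm (h \<xi>))\<^sup>2)"
    by (rule integral_cong_AE) (use AE_h in \<open>auto elim!: eventually_mono\<close>)
  also have "\<dots> = ?k * (LINT \<xi>|lborel. symbol (m / c) s (inverse c *\<^sub>R \<xi>) * (norm (g (inverse c *\<^sub>R \<xi>)))\<^sup>2)"
    unfolding hk by (rule integral_mult_right_zero)
  also have "(LINT \<xi>|lborel. symbol (m / c) s (inverse c *\<^sub>R \<xi>) * (norm (g (inverse c *\<^sub>R \<xi>)))\<^sup>2) = c ^ DIM('a) * ?I"
    using integral_lborel_affine[of "\<lambda>\<xi>. symbol (m / c) s \<xi> * (norm (g \<xi>))\<^sup>2" "inverse c" 0] c0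
    by (simp add: power_inverse field_simps)
  also have "?k * (c ^ DIM('a) * ?I) = c powr (2 * s) / c powr ?N * ?I"
    using c0 by (simp add: power2_eq_square powr_realpow)
  also have "c powr (2 * s) / c powr ?N = 1 / c powr (?N - 2 * s)"
    by (simp add: powr_diff)
  finally have num: "(LINT \<xi>|lborel. symbol m s \<xi> * (norm (fourier_L2 ?v \<xi>))\<^sup>2) = ?I / c powr (?N - 2 * s)"
    by simp
  have "?D = c ^ DIM('a) * (LINT x|lborel. \<bar>?v x\<bar> powr ?p)"
    using integral_lborel_affine[of "\<lambda>x. \<bar>u x\<bar> powr ?p" c 0] c0 by simp
  then have den: "(LINT x|lborel. \<bar>?v x\<bar> powr ?p) = ?D / c powr ?N"
    using c0 by (simp add: powr_realpow)
  have "(?D / c powr ?N) powr (2 / ?p) = ?D powr (2 / ?p) / c powr (?N * (2 / ?p))"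
    by (simp add: powr_divide powr_powr)
  also have "?N * (2 / ?p) = ?N - 2 * s"
    using s by (simp add: critical_exponent_def)
  finally show "Lambda_quotient m s ?v = Lambda_quotient (m / c) s u"
    unfolding Lambda_quotient_symbol num den g_def[symmetric] using c0 by simp
qed

text \<open>Dominated convergence with the mass \<open>m\<close> integrand as majorant; the
  denominator does not depend on the mass.\<close>

lemma tendsto_Lambda_quotient:
  fixes u :: "'a::euclidean_space \<Rightarrow> real"
  assumes s: "0 < s" and u: "u \<in> Hs m s"
  shows "(\<lambda>n. Lambda_quotient (m / real (Suc n)) s u) \<longlonglongrightarrow> S_quotient s u"
proof -
  define g where "g = fourier_L2 u"
  have sq: "square_integrable u" and int: "integrable lborel (\<lambda>\<xi>. symbol m s \<xi> * (norm (g \<xi>))\<^sup>2)"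
    using u by (auto simp: Hs_iff g_def)
  have [measurable]: "g \<in> borel_measurable borel"
    using square_integrable_fourier_L2[OF sq] by (auto simp: g_def dest: square_integrable_measurable)
  have "(\<lambda>n. LINT \<xi>|lborel. symbol (m / real (Suc n)) s \<xi> * (norm (g \<xi>))\<^sup>2)
      \<longlonglongrightarrow> (LINT \<xi>|lborel. symbol 0 s \<xi> * (norm (g \<xi>))\<^sup>2)"
  proof (rule Bochner_Integration.integral_dominated_convergence[OF _ _ int])
    show "AE \<xi> in lborel. (\<lambda>n. symbol (m / real (Suc n)) s \<xi> * (norm (g \<xi>))\<^sup>2)
        \<longlonglongrightarrow> symbol 0 s \<xi> * (norm (g \<xi>))\<^sup>2"
    proof (rule AE_I2)
      fix \<xi> :: 'a
      have "(\<lambda>n. m * (1 / real (Suc n))) \<longlonglongrightarrow> m * 0"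
        by (intro tendsto_intros LIMSEQ_Suc[OF lim_1_over_n])
      then have "(\<lambda>n. m / real (Suc n)) \<longlonglongrightarrow> 0"
        by simp
      \<comment> \<open>At the origin the base tends to 0, where continuity of \<open>powr\<close>
        rests on s > 0 and a nonnegative base.\<close>
      then have "(\<lambda>n. symbol (m / real (Suc n)) s \<xi>) \<longlonglongrightarrow> symbol 0 s \<xi>"
        unfolding symbol_def using s
        by (intro tendsto_powr' tendsto_intros always_eventually allI disjI2 conjI) auto
      then show "(\<lambda>n. symbol (m / real (Suc n)) s \<xi> * (norm (g \<xi>))\<^sup>2)
        \<longlonglongrightarrow> symbol 0 s \<xi> * (norm (g \<xi>))\<^sup>2"
        by (intro tendsto_intros)
    qed
    fix n
    have "\<bar>m\<bar> / real (Suc n) \<le> \<bar>m\<bar> / 1"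
      by (intro divide_left_mono) auto
    then have "symbol (m / real (Suc n)) s \<xi> \<le> symbol m s \<xi>" for \<xi> :: 'a
      by (intro symbol_mono s) (simp add: abs_divide)
    then show "AE \<xi> in lborel. norm (symbol (m / real (Suc n)) s \<xi> * (norm (g \<xi>))\<^sup>2) \<le> symbol m s \<xi> * (norm (g \<xi>))\<^sup>2"
      by (auto simp: abs_mult intro!: mult_right_mono)
  qed measurable
  then show ?thesis
    unfolding S_quotient_eq_Lambda_quotient Lambda_quotient_symbol g_def divide_inverse
    by (rule tendsto_mult_right)
qed

text \<open>The test function that makes the space of competitors nonempty, and with it the infimum
  finite.\<close>

lemma gauss_in_Hs_nonzero:
  assumes s: "0 < s" "s < 1"
  shows "(gauss :: 'a::euclidean_space \<Rightarrow> real) \<in> Hs_nonzero m s"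
proof -
  let ?u = "gauss :: 'a \<Rightarrow> real"
  have "?u x * ?u x \<le> ?u x * 1" for x
    by (intro mult_left_mono) auto
  then have sq: "square_integrable ?u"
    unfolding square_integrable_def
    by (intro conjI Bochner_Integration.integrable_bound[OF integrable_gauss]) (auto simp: power2_eq_square)
  have "has_fourier_L2 (\<lambda>x. complex_of_real (?u x)) (fourier_integral (\<lambda>x. complex_of_real (?u x)))"
    by (intro has_fourier_L2_fourier_integral square_integrable_of_real sq integrable_of_real integrable_gauss)
  then have AE_hat: "AE \<xi> in lborel. fourier_L2 ?u \<xi> = fourier_integral (\<lambda>x. complex_of_real (?u x)) \<xi>"
    by (rule has_fourier_L2_unique[OF square_integrable_of_real[OF sq] has_fourier_L2_fourier_L2[OF sq]])
  have [measurable]: "fourier_L2 ?u \<in> borel_measurable borel"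
    using square_integrable_fourier_L2[OF sq] by (auto dest: square_integrable_measurable)
  \<comment> \<open>One of the two factors \<open>gauss_hat\<close> absorbs the growth of the
    symbol: the symbol is at most 2 (1 + m^2) exp (y/2), and that factor is sqrt(2 pi)^N exp (-y/2).
    The other one remains as the majorant.\<close>
  let ?c = "2 * (1 + m\<^sup>2) * sqrt (2 * pi) ^ DIM('a)"
  have "integrable lborel (\<lambda>\<xi>::'a. symbol m s \<xi> * (gauss_hat \<xi>)\<^sup>2)"
  proof (rule Bochner_Integration.integrable_bound)
    show "integrable lborel (\<lambda>\<xi>::'a. ?c * gauss_hat \<xi>)"
      by (intro integrable_mult_right integrable_gauss_hat)
    have "symbol m s \<xi> * (gauss_hat \<xi>)\<^sup>2 \<le> ?c * gauss_hat \<xi>" for \<xi> :: 'a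
    proof -
      define y where "y = 4 * pi\<^sup>2 * (norm \<xi>)\<^sup>2"
      define e where "e = gauss ((2 * pi) *\<^sub>R \<xi>)"
      have y: "y \<ge> 0" by (simp add: y_def)
      have e: "e = exp (- (y / 2))"
        by (simp add: e_def gauss_def y_def power_mult_distrib)
      have "(m\<^sup>2 + y) powr s \<le> (m\<^sup>2 + y) + 1"
      proof (cases "m\<^sup>2 + y \<le> 1")
        case True
        then have "(m\<^sup>2 + y) powr s \<le> 1"
          using y s by (intro powr_le1) auto
        then show ?thesis using y by (simp add: add_nonneg_nonneg add_increasing)
      next
        case False
        then have "(m\<^sup>2 + y) powr s \<le> (m\<^sup>2 + y) powr 1"
          using s by (intro powr_mono) auto
        then show ?thesis using False by simp
      qed
      also have "m\<^sup>2 + y + 1 \<le> (1 + m\<^sup>2) * (1 + y)"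
        using y by (simp add: algebra_simps)
      also have "\<dots> \<le> (1 + m\<^sup>2) * (2 * exp (y / 2))"
      proof (rule mult_left_mono)
        show "1 + y \<le> 2 * exp (y / 2)"
          using exp_ge_add_one_self[of "y / 2"] y by linarith
      qed simp
      finally have "symbol m s \<xi> \<le> (1 + m\<^sup>2) * (2 * exp (y / 2))"
        by (simp add: symbol_def y_def)
      then have "symbol m s \<xi> * e \<le> (1 + m\<^sup>2) * (2 * exp (y / 2)) * e"
        by (rule mult_right_mono) (simp add: e)
      also have "\<dots> = 2 * (1 + m\<^sup>2)"
        by (simp add: e exp_minus field_simps)
      finally have "symbol m s \<xi> * e * (sqrt (2 * pi) ^ DIM('a) * gauss_hat \<xi>)
          \<le> 2 * (1 + m\<^sup>2) * (sqrt (2 * pi) ^ DIM('a) * gauss_hat \<xi>)"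
        by (rule mult_right_mono) simp
      moreover have "gauss_hat \<xi> = sqrt (2 * pi) ^ DIM('a) * e"
        by (simp add: gauss_hat_def e_def)
      ultimately show ?thesis
        by (simp add: power2_eq_square mult_ac)
    qed
    then show "AE \<xi>::'a in lborel. norm (symbol m s \<xi> * (gauss_hat \<xi>)\<^sup>2) \<le> norm (?c * gauss_hat \<xi>)"
      by (auto simp: abs_mult)
  qed measurable
  moreover have "integrable lborel (\<lambda>\<xi>. symbol m s \<xi> * (norm (fourier_L2 ?u \<xi>))\<^sup>2) \<longleftrightarrow>
      integrable lborel (\<lambda>\<xi>::'a. symbol m s \<xi> * (gauss_hat \<xi>)\<^sup>2)"
    by (rule integrable_cong_AE)
       (use AE_hat in \<open>auto simp: fourier_integral_gauss elim!: eventually_mono\<close>)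
  ultimately have "?u \<in> Hs m s"
    using sq by (simp add: Hs_iff)
  moreover have "\<not> (AE x in lborel. ?u x = 0)"
  proof
    assume "AE x in lborel. ?u x = 0"
    then have "AE x in (lborel :: 'a measure). False"
      by eventually_elim (metis gauss_pos less_irrefl)
    then have "(LINT x|lborel. gauss_hat (x::'a)) = (LINT x|(lborel :: 'a measure). 0)"
      by (intro integral_cong_AE) auto
    then show False
      by (simp add: integral_gauss_hat)
  qed
  ultimately show ?thesis
    by (simp add: Hs_nonzero_def)
qed

text \<open>The infima live in \<open>ereal\<close>, where an empty set of competitors would give
  \<infinity>; finiteness is thus a real assertion.\<close>

theorem fractional_Sobolev_constants:
  fixes s m :: real and \<Lambda> S :: ereal
  assumes s: "0 < s" "s < 1" "2 * s < real DIM('a::euclidean_space)" and m: "m > 0"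
    and \<Lambda>: "\<Lambda> = (INF u \<in> (Hs_nonzero m s :: ('a \<Rightarrow> real) set). ereal (Lambda_quotient m s u))"
    and S: "S = (INF u \<in> (Hs_nonzero m s :: ('a \<Rightarrow> real) set). ereal (S_quotient s u))"
  shows "0 < \<Lambda>" "\<Lambda> < \<infinity>" "\<not> (\<exists>u \<in> (Hs_nonzero m s :: ('a \<Rightarrow> real) set). ereal (Lambda_quotient m s u) = \<Lambda>)" "\<Lambda> = S"
proof -
  let ?H = "Hs_nonzero m s :: ('a \<Rightarrow> real) set"
  obtain c where c: "c > 0"
    and bounds: "\<And>u. u \<in> ?H \<Longrightarrow> c \<le> S_quotient s u"
      "\<And>u. u \<in> ?H \<Longrightarrow> S_quotient s u < Lambda_quotient m s u"
    using Hs_nonzero_bounds[OF s(1,3) m] by blast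
  have "ereal c \<le> S"
    unfolding S by (intro INF_greatest) (simp add: bounds)
  moreover have "S \<le> \<Lambda>"
    unfolding S \<Lambda> by (intro INF_mono) (use bounds(2) in \<open>auto intro: less_imp_le\<close>)
  moreover have "\<Lambda> \<le> S"
    unfolding S
  proof (rule INF_greatest)
    fix u assume u: "u \<in> ?H"
    show "\<Lambda> \<le> ereal (S_quotient s u)"
    proof (rule LIMSEQ_le_const)
      show "(\<lambda>n. ereal (Lambda_quotient (m / real (Suc n)) s u)) \<longlonglongrightarrow> ereal (S_quotient s u)"
        using tendsto_Lambda_quotient[OF s(1)] u by (auto simp: Hs_nonzero_def)
      \<comment> \<open>The quotient of smaller mass at \<open>u\<close> is the quotient of mass
        \<open>m\<close> at a dilate of \<open>u\<close>, which is again a competitor;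
        \<open>Suc n\<close> provides a dilation factor of at least 1.\<close>
      have "\<Lambda> \<le> ereal (Lambda_quotient (m / real (Suc n)) s u)" for n
      proof -
        have n: "1 \<le> real (Suc n)" by simp
        show ?thesis
          unfolding \<Lambda> Lambda_quotient_scale[OF s(1,3) u n, symmetric]
          by (rule INF_lower[OF Hs_nonzero_scale[OF s(1,3) u n]])
      qed
      then show "\<exists>N. \<forall>n\<ge>N. \<Lambda> \<le> ereal (Lambda_quotient (m / real (Suc n)) s u)"
        by blast
    qed
  qed
  ultimately show eq: "\<Lambda> = S" and "0 < \<Lambda>"
    using c by (auto intro: less_le_trans[of _ "ereal c"])
  have "\<Lambda> \<le> ereal (Lambda_quotient m s (gauss :: 'a \<Rightarrow> real))"
    unfolding \<Lambda> by (rule INF_lower[OF gauss_in_Hs_nonzero[OF s(1,2)]])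
  then show "\<Lambda> < \<infinity>"
    by (rule le_less_trans) simp
  show "\<not> (\<exists>u \<in> ?H. ereal (Lambda_quotient m s u) = \<Lambda>)"
  proof
    assume "\<exists>u \<in> ?H. ereal (Lambda_quotient m s u) = \<Lambda>"
    then obtain u where u: "u \<in> ?H" "ereal (Lambda_quotient m s u) = \<Lambda>" by blast
    have "\<Lambda> \<le> ereal (S_quotient s u)"
      unfolding eq S by (rule INF_lower[OF u(1)])
    with u(2) bounds(2)[OF u(1)] show False
      by auto
  qed
qed

text \<open>Specialisation to \<open>real ^ 'n\<close>, whose dimension N is the cardinality of the
  finite index type.\<close>

theorem mainTheorem4:
  fixes s m :: real and \<Lambda> S :: ereal
  assumes "0 < s" and "s < 1"
    and "real CARD('n::finite) > 2 * s"
    and "m > 0"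
    and "\<Lambda> = (INF u \<in> (Hs_nonzero m s :: (real ^ 'n \<Rightarrow> real) set). ereal (Lambda_quotient m s u))"
    and "S = (INF u \<in> (Hs_nonzero m s :: (real ^ 'n \<Rightarrow> real) set). ereal (S_quotient s u))"
  shows "0 < \<Lambda> \<and> \<Lambda> < \<infinity>
    \<and> \<not> (\<exists>u \<in> (Hs_nonzero m s :: (real ^ 'n \<Rightarrow> real) set). ereal (Lambda_quotient m s u) = \<Lambda>)
    \<and> \<Lambda> = S"
proof -
  have "2 * s < real DIM(real ^ 'n)"
    using assms(3) by simp
  from fractional_Sobolev_constants[OF assms(1,2) this assms(4-6)]
  show ?thesis by blast
qed

end
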